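(* Let $\beta>1/2$, and let $\{X_i\}_{i=1}^n$ be i.i.d. random variables with distribution $P_{f_\varepsilon}=(1-\varepsilon)P_f+\varepsilon G$, where $P_f$ is the distribution with density $f\in\mathcal{F}_\beta$ (the Sobolev class defined in the context via the trigonometric basis) and $G$ is an arbitrary distribution on $[0,1]$. For $\alpha\in(0,1)$ and $\varepsilon\in[0,1]$, the private projection estimator $\hat f$ defined in the context, with privacy mechanism $Q$, satisfies $$\mathbb{E}_{P_{f_\varepsilon},Q}[\|\hat f-f\|_2^2]\ \lesssim\ \varepsilon^{\frac{4\beta}{2\beta+1}}\ \vee\ (n\alpha^2)^{-\frac{2\beta}{2\beta+2}},$$ when the tuning parameter $k$ is chosen to be $k\asymp\varepsilon^{-\frac{2}{2\beta+1}}\wedge(n\alpha^2)^{\frac{1}{2\beta+2}}$.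
   Context: Trigonometric basis of $L^2[0,1]$: $\varphi_1(x)=1$, $\varphi_{2j}(x)=\sqrt2\cos(2\pi jx)$, $\varphi_{2j+1}(x)=\sqrt2\sin(2\pi jx)$, $j\in\mathbb{N}_+$. The Sobolev class is $$\mathcal{F}_\beta=\Big\{f:[0,1]\to\mathbb{R}_+:\ \int_0^1f=1,\ \sum_{j=1}^\infty j^{2\beta}\theta_j^2\le r^2\Big\},\qquad\theta_j=\int_0^1f\varphi_j,$$ with $r>0$ a fixed constant. Privacy mechanism $Q$ (non-interactive, applied independently to each $X_i$): let $B_0=\sqrt2$ and $v=(\varphi_1(X_i),\dots,\varphi_k(X_i))\in\mathbb{R}^k$, with $k\in\mathbb{N}_+$ the tuning parameter. Draw $\widetilde V\in\{-B_0,B_0\}^k$ with independent coordinates, $\mathbb{P}(\widetilde V_j=B_0)=\frac12+\frac{v_j}{2B_0}$. Draw $T\sim\mathrm{Bernoulli}(e^\alpha/(e^\alpha+1))$ independently of $\widetilde V$ and the data. If $T=1$, draw $Z_i$ uniformly from $\{z\in\{-B,B\}^k:\langle z,\widetilde V\rangle\ge0\}$; if $T=0$, uniformly from $\{z\in\{-B,B\}^k:\langle z,\widetilde V\rangle\le0\}$. Here $B=B_0C_k\frac{e^\alpha+1}{e^\alpha-1}$ with $$C_d^{-1}=\frac{1}{2^{d-1}}\binom{d-1}{(d-1)/2}\ (d\text{ odd}),\qquad C_d^{-1}=\frac{2}{2^d+\binom{d}{d/2}}\binom{d-1}{d/2}\ (d\text{ even}).$$ (Then $\mathbb{E}_Q[Z_{i,j}|X_i]=\varphi_j(X_i)$,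 $Z_{i,j}\in\{-B,B\}$ and $B\lesssim\sqrt k/\alpha$.) Estimator: $\hat f=\sum_{j=1}^k\big(\frac1n\sum_{i=1}^nZ_{i,j}\big)\varphi_j$. $\|g\|_2^2=\int_0^1g^2$; $a\wedge b=\min(a,b)$, $a\vee b=\max(a,b)$; $\varepsilon^{-2/(2\beta+1)}=+\infty$ if $\varepsilon=0$. The quantities $\alpha,\varepsilon$ may depend on $n$, with $n\alpha^2\to\infty$. $a_n\lesssim b_n$ means there is a constant $C>0$ (depending only on fixed quantities such as $\beta,r$) with $\limsup_na_n/b_n\le C$; $a_n\asymp b_n$ means $a_n\lesssim b_n\lesssim a_n$. *)

theory Defs
  imports "HOL-Probability.Probability"
begin

abbreviation unit_interval :: "real measure" where
  "unit_interval \<equiv> restrict_space lborel {0..1}"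

text \<open>The basis is indexed from 1; the value at index 0 is never used.\<close>

definition trig_basis :: "nat \<Rightarrow> real \<Rightarrow> real" where
  "trig_basis j x =
     (if j = 1 then 1
      else if even j then sqrt 2 * cos (2 * pi * real (j div 2) * x)
      else sqrt 2 * sin (2 * pi * real (j div 2) * x))"

definition trig_coeff :: "(real \<Rightarrow> real) \<Rightarrow> nat \<Rightarrow> real" where
  "trig_coeff f j = (\<integral>x. f x * trig_basis j x \<partial>unit_interval)"

text \<open>The series is taken in \<^typ>\<open>ennreal\<close>, so that the bound includes its convergence.\<close>

definition sobolev_class :: "real \<Rightarrow> real \<Rightarrow> (real \<Rightarrow> real) set" where
  "sobolev_class \<beta> r =
     {f. (\<forall>x\<in>{0..1}. 0 \<le> f x) \<and> integrable unit_interval f \<and>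
         (\<integral>x. f x \<partial>unit_interval) = 1 \<and>
         (\<Sum>j. ennreal (real (Suc j) powr (2 * \<beta>) * (trig_coeff f (Suc j))\<^sup>2)) \<le> ennreal (r\<^sup>2)}"

definition contaminated :: "real \<Rightarrow> (real \<Rightarrow> real) \<Rightarrow> real measure \<Rightarrow> real measure" where
  "contaminated \<epsilon> f G =
     measure_of {0..1} (sets unit_interval)
       (\<lambda>A. ennreal (1 - \<epsilon>) * emeasure (density unit_interval (\<lambda>x. ennreal (f x))) A
          + ennreal \<epsilon> * emeasure G A)"

lemma space_contaminated: "space (contaminated \<epsilon> f G) = {0..1}"
  by (simp add: contaminated_def space_measure_of_conv space_restrict_space)

lemma sets_contaminated: "sets (contaminated \<epsilon> f G) = sets unit_interval"
proof -
  have "sigma_algebra {0..1::real} (sets unit_interval)"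
    using sets.sigma_algebra_axioms[of unit_interval] by (simp add: space_restrict_space)
  then show ?thesis
    unfolding contaminated_def by (simp add: sigma_algebra.sets_measure_of_eq)
qed

lemma emeasure_contaminated:
  assumes G: "sets G = sets unit_interval" and A: "A \<in> sets unit_interval"
  shows "emeasure (contaminated \<epsilon> f G) A =
           ennreal (1 - \<epsilon>) * emeasure (density unit_interval (\<lambda>x. ennreal (f x))) A
           + ennreal \<epsilon> * emeasure G A"
  unfolding contaminated_def
proof (rule emeasure_measure_of_sigma)
  let ?m = "\<lambda>A. ennreal (1 - \<epsilon>) * emeasure (density unit_interval (\<lambda>x. ennreal (f x))) A
              + ennreal \<epsilon> * emeasure G A"
  show "sigma_algebra {0..1::real} (sets unit_interval)"
    using sets.sigma_algebra_axioms[of unit_interval] by (simp add: space_restrict_space)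
  show "positive (sets unit_interval) ?m"
    by (simp add: positive_def)
  show "countably_additive (sets unit_interval) ?m"
  proof (rule countably_additiveI)
    fix F :: "nat \<Rightarrow> real set"
    assume F: "range F \<subseteq> sets unit_interval" "disjoint_family F"
    have "(\<Sum>i. ?m (F i)) =
        ennreal (1 - \<epsilon>) * (\<Sum>i. emeasure (density unit_interval (\<lambda>x. ennreal (f x))) (F i))
        + ennreal \<epsilon> * (\<Sum>i. emeasure G (F i))"
      by (simp add: suminf_add[symmetric] ennreal_suminf_cmult)
    then show "(\<Sum>i. ?m (F i)) = ?m (\<Union>i. F i)"
      using F G by (simp add: suminf_emeasure)
  qed
qed (use A in auto)

definition B0 :: real where
  "B0 = sqrt 2"

definition C_const :: "nat \<Rightarrow> real" where
  "C_const d = inverse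
     (if odd d then 1 / 2 ^ (d - 1) * real ((d - 1) choose ((d - 1) div 2))
      else 2 / (2 ^ d + real (d choose (d div 2))) * real ((d - 1) choose (d div 2)))"

definition B_const :: "real \<Rightarrow> nat \<Rightarrow> real" where
  "B_const \<alpha> k = B0 * C_const k * ((exp \<alpha> + 1) / (exp \<alpha> - 1))"

text \<open>Vectors of length \<open>k\<close> are functions on \<open>{1..k}\<close>, extended by 0.\<close>

definition half_cube :: "real \<Rightarrow> nat \<Rightarrow> (nat \<Rightarrow> real) \<Rightarrow> bool \<Rightarrow> (nat \<Rightarrow> real) set" where
  "half_cube B k v t =
     {z \<in> PiE_dflt {1..k} 0 (\<lambda>_. {- B, B}).
        if t then 0 \<le> (\<Sum>j=1..k. z j * v j) else (\<Sum>j=1..k. z j * v j) \<le> 0}"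

definition privacy_mechanism :: "real \<Rightarrow> nat \<Rightarrow> real \<Rightarrow> (nat \<Rightarrow> real) pmf" where
  "privacy_mechanism \<alpha> k x =
     bind_pmf
       (Pi_pmf {1..k} 0 (\<lambda>j. map_pmf (\<lambda>b. if b then B0 else - B0)
                               (bernoulli_pmf (1 / 2 + trig_basis j x / (2 * B0)))))
       (\<lambda>v. bind_pmf (bernoulli_pmf (exp \<alpha> / (exp \<alpha> + 1)))
          (\<lambda>t. pmf_of_set (half_cube (B_const \<alpha> k) k v t)))"

text \<open>Conditional law of \<open>Z\<^sub>0, \<dots>, Z\<^bsub>n-1\<^esub>\<close> given the data \<open>X\<^sub>0, \<dots>, X\<^bsub>n-1\<^esub>\<close>;
  the first argument of \<open>Z\<close> is the observation, the second one the coordinate.\<close>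

definition private_sample :: "real \<Rightarrow> nat \<Rightarrow> nat \<Rightarrow> (nat \<Rightarrow> real) \<Rightarrow> (nat \<Rightarrow> nat \<Rightarrow> real) pmf" where
  "private_sample \<alpha> k n X = Pi_pmf {..<n} (\<lambda>_. 0) (\<lambda>i. privacy_mechanism \<alpha> k (X i))"

definition projection_estimator :: "nat \<Rightarrow> nat \<Rightarrow> (nat \<Rightarrow> nat \<Rightarrow> real) \<Rightarrow> real \<Rightarrow> real" where
  "projection_estimator k n Z x =
     (\<Sum>j=1..k. (1 / real n * (\<Sum>i<n. Z i j)) * trig_basis j x)"

definition sq_L2_norm :: "(real \<Rightarrow> real) \<Rightarrow> ennreal" where
  "sq_L2_norm g = (\<integral>\<^sup>+x. ennreal ((g x)\<^sup>2) \<partial>unit_interval)"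

text \<open>Expectation over i.i.d. data from \<open>P\<close>, and over the mechanism given the data.\<close>

definition private_risk ::
  "real \<Rightarrow> nat \<Rightarrow> nat \<Rightarrow> real measure \<Rightarrow> (real \<Rightarrow> real) \<Rightarrow> ennreal" where
  "private_risk \<alpha> k n P f =
     (\<integral>\<^sup>+X. (\<integral>\<^sup>+Z. sq_L2_norm (\<lambda>x. projection_estimator k n Z x - f x)
               \<partial>measure_pmf (private_sample \<alpha> k n X))
        \<partial>(PiM {..<n} (\<lambda>_. P)))"

text \<open>The convention that a negative power of \<open>\<epsilon> = 0\<close> is infinite is spelled out, because
  \<open>0 powr a = 0\<close>.\<close>

definition tuning_rate :: "real \<Rightarrow> nat \<Rightarrow> real \<Rightarrow> real \<Rightarrow> real" where
  "tuning_rate \<beta> n \<alpha> \<epsilon> =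
     (if \<epsilon> = 0 then (real n * \<alpha>\<^sup>2) powr (1 / (2 * \<beta> + 2))
      else min (\<epsilon> powr (- 2 / (2 * \<beta> + 1))) ((real n * \<alpha>\<^sup>2) powr (1 / (2 * \<beta> + 2))))"

definition risk_rate :: "real \<Rightarrow> nat \<Rightarrow> real \<Rightarrow> real \<Rightarrow> real" where
  "risk_rate \<beta> n \<alpha> \<epsilon> =
     max (\<epsilon> powr (4 * \<beta> / (2 * \<beta> + 1))) ((real n * \<alpha>\<^sup>2) powr (- (2 * \<beta>) / (2 * \<beta> + 2)))"

text \<open>The order relation between nonnegative sequences, with its constant made explicit.\<close>

definition lesssim_by :: "real \<Rightarrow> (nat \<Rightarrow> ennreal) \<Rightarrow> (nat \<Rightarrow> ennreal) \<Rightarrow> bool" where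
  "lesssim_by C a b \<longleftrightarrow> limsup (\<lambda>n. a n / b n) \<le> ennreal C"

end

theory Submission
  imports Defs
begin

text \<open>Conditionally on the data, the mechanism is unbiased, because \<open>C_const k\<close> is the reciprocal of the
  mean of one sign, seen from a fixed vertex, over the half of the cube around that vertex. As
  \<open>(B_const \<alpha> k)\<^sup>2\<close> is of order \<open>k / \<alpha>\<^sup>2\<close>, each of the \<open>k\<close> estimated coefficients has variance of order
  \<open>k / (n \<alpha>\<^sup>2)\<close>, and contamination biases each of them by at most a multiple of \<open>\<epsilon>\<close>. Hence the risk is
  at most a multiple of \<open>k\<^sup>2 / (n \<alpha>\<^sup>2) + k \<epsilon>\<^sup>2\<close> plus the squared truncation error, and the tuning rate
  balances these terms.

  The truncation error is \<open>r\<^sup>2 k powr (- 2 \<beta>)\<close> by orthonormality, once \<open>f\<close> is known to be a.e. the sum of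
  its trigonometric series. Densities in the class are only assumed integrable; but the coefficients
  are absolutely summable since \<open>\<beta> > 1 / 2\<close>, so the series is a bounded function with the same
  coefficients, and an integrable function all of whose coefficients vanish is zero a.e. by
  Stone--Weierstrass on the circle.\<close>

section \<open>Orthonormality and completeness of the trigonometric basis\<close>

text \<open>All basis functions take equal values at 0 and 1, so their span is not uniformly dense
  in the continuous functions on the interval. This is why completeness is argued on the circle,
  through x -> \<open>cis (2 * pi * x)\<close>, which identifies only the two endpoints, a null set.
  The truncation error then follows from Fatou's lemma: almost everywhere convergence of the series
  is all that is taken from completeness.

  The mean square error of a coefficient is split twice into variance and squared bias: first over
  the mechanism with the data fixed, then over the data. The variance dominates the truncation error
  k^(-2\<beta>) once k exceeds (n \<alpha>^2)^(1/(2\<beta>+2)), where k^2/(n \<alpha>^2) =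
  k^(-2\<beta>); the contamination bias does so beyond \<epsilon>^(-2/(2\<beta>+1)), where k
  \<epsilon>^2 = k^(-2\<beta>). The smaller of the two values is the tuning rate.

  The final constant is fixed before all sequences, and the density and the contamination may change
  with n. Hence the risk is first bounded for each single n with numerical constants, and limits
  enter only at the very end.\<close>

lemma continuous_integrable_unit_interval:
  fixes f :: "real \<Rightarrow> real"
  assumes "continuous_on {0..1} f"
  shows "integrable unit_interval f"
  using borel_integrable_atLeastAtMost'[OF assms]
  by (simp add: integrable_restrict_space set_integrable_def)

section \<open>Orthonormality of the trigonometric system\<close>

lemma integral_unit_interval_FTC:
  fixes f F :: "real \<Rightarrow> real"
  assumes "\<And>x. (F has_real_derivative f x) (at x)" and "continuous_on {0..1} f"
  shows "(\<integral>x. f x \<partial>unit_interval) = F 1 - F 0"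
proof -
  have "(\<integral>x. f x \<partial>unit_interval) = (\<integral>x. indicator {0..1} x *\<^sub>R f x \<partial>lborel)"
    by (simp add: integral_restrict_space)
  also have "\<dots> = F 1 - F 0"
    by (rule integral_FTC_atLeastAtMost)
      (use assms in \<open>auto simp: has_real_derivative_iff_has_vector_derivative
        intro: has_vector_derivative_at_within\<close>)
  finally show ?thesis .
qed

text \<open>Frequencies are integers rather than naturals because the product-to-sum formulas
  produce the difference of two frequencies.\<close>

lemma integral_cos_unit_interval:
  fixes m :: int
  shows "(\<integral>x. cos (2 * pi * real_of_int m * x) \<partial>unit_interval) = (if m = 0 then 1 else 0)"
proof (cases "m = 0")
  case True
  then show ?thesis
    using integral_unit_interval_FTC[of "\<lambda>x. x" "\<lambda>_. 1"] by (simp add: DERIV_ident)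
next
  case False
  have "(\<integral>x. cos (2 * pi * real_of_int m * x) \<partial>unit_interval)
      = sin (2 * pi * real_of_int m * 1) / (2 * pi * m) - sin (2 * pi * real_of_int m * 0) / (2 * pi * m)"
    by (rule integral_unit_interval_FTC)
       (use False in \<open>auto intro!: derivative_eq_intros continuous_intros\<close>)
  then show ?thesis using False by (simp add: sin_integer_2pi)
qed

lemma integral_sin_unit_interval:
  fixes m :: int
  shows "(\<integral>x. sin (2 * pi * real_of_int m * x) \<partial>unit_interval) = 0"
proof (cases "m = 0")
  case False
  have "(\<integral>x. sin (2 * pi * real_of_int m * x) \<partial>unit_interval)
      = - cos (2 * pi * real_of_int m * 1) / (2 * pi * m) - (- cos (2 * pi * real_of_int m * 0) / (2 * pi * m))"
    by (rule integral_unit_interval_FTC)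
       (use False in \<open>auto intro!: derivative_eq_intros continuous_intros\<close>)
  then show ?thesis using False by (simp add: cos_integer_2pi)
qed simp

lemma integral_cos_cos:
  fixes m n :: int
  shows "(\<integral>x. cos (2 * pi * real_of_int m * x) * cos (2 * pi * real_of_int n * x) \<partial>unit_interval)
    = ((if m = n then 1 else 0) + (if m = - n then 1 else 0)) / 2"
proof -
  have "(\<lambda>x. cos (2 * pi * real_of_int m * x) * cos (2 * pi * real_of_int n * x))
    = (\<lambda>x. (cos (2 * pi * real_of_int (m - n) * x) + cos (2 * pi * real_of_int (m + n) * x)) / 2)"
    by (simp add: cos_times_cos algebra_simps)
  then show ?thesis
    \<comment> \<open>The conditions \<open>m = n\<close> and \<open>m = - n\<close> are rewritten
      to \<open>m - n = 0\<close> and \<open>m + n = 0\<close>, the form in which the cosine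
      integrals deliver them.\<close>
    by (simp only: integral_divide_zero)
      (subst Bochner_Integration.integral_add,
        auto intro!: continuous_integrable_unit_interval continuous_intros
          simp only: integral_cos_unit_interval eq_iff_diff_eq_0[of m] diff_minus_eq_add)
qed

lemma integral_sin_sin:
  fixes m n :: int
  shows "(\<integral>x. sin (2 * pi * real_of_int m * x) * sin (2 * pi * real_of_int n * x) \<partial>unit_interval)
    = ((if m = n then 1 else 0) - (if m = - n then 1 else 0)) / 2"
proof -
  have "(\<lambda>x. sin (2 * pi * real_of_int m * x) * sin (2 * pi * real_of_int n * x))
    = (\<lambda>x. (cos (2 * pi * real_of_int (m - n) * x) - cos (2 * pi * real_of_int (m + n) * x)) / 2)"
    by (simp add: sin_times_sin algebra_simps)
  then show ?thesis
    by (simp only: integral_divide_zero)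
      (subst Bochner_Integration.integral_diff,
        auto intro!: continuous_integrable_unit_interval continuous_intros
          simp only: integral_cos_unit_interval eq_iff_diff_eq_0[of m] diff_minus_eq_add)
qed

lemma integral_sin_cos:
  fixes m n :: int
  shows "(\<integral>x. sin (2 * pi * real_of_int m * x) * cos (2 * pi * real_of_int n * x) \<partial>unit_interval) = 0"
proof -
  have "(\<lambda>x. sin (2 * pi * real_of_int m * x) * cos (2 * pi * real_of_int n * x))
    = (\<lambda>x. (sin (2 * pi * real_of_int (m + n) * x) + sin (2 * pi * real_of_int (m - n) * x)) / 2)"
    unfolding sin_times_cos by (simp add: algebra_simps)
  then have "(\<integral>x. sin (2 * pi * real_of_int m * x) * cos (2 * pi * real_of_int n * x) \<partial>unit_interval)
    = ((\<integral>x. sin (2 * pi * real_of_int (m + n) * x) \<partial>unit_interval)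
       + (\<integral>x. sin (2 * pi * real_of_int (m - n) * x) \<partial>unit_interval)) / 2"
    by (simp only: integral_divide_zero)
      (subst Bochner_Integration.integral_add,
        auto intro!: continuous_integrable_unit_interval continuous_intros)
  then show ?thesis
    unfolding integral_sin_unit_interval by simp
qed

lemma continuous_on_trig_basis [continuous_intros]: "continuous_on A (trig_basis j)"
  unfolding trig_basis_def by (cases "j = 1"; cases "even j") (auto intro!: continuous_intros)

lemma trig_basis_measurable [measurable]: "trig_basis j \<in> borel_measurable borel"
  by (intro borel_measurable_continuous_onI continuous_intros)

lemma abs_trig_basis_le: "\<bar>trig_basis j x\<bar> \<le> sqrt 2"
proof -
  have "sqrt 2 * \<bar>cos t\<bar> \<le> sqrt 2 * 1" "sqrt 2 * \<bar>sin t\<bar> \<le> sqrt 2 * 1" for t :: real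
    by (intro mult_left_mono; simp)+
  moreover have "1 \<le> sqrt (2::real)" by simp
  ultimately show ?thesis by (auto simp: trig_basis_def abs_mult)
qed

lemma trig_basis_orthonormal:
  assumes "1 \<le> i" "1 \<le> j"
  shows "(\<integral>x. trig_basis i x * trig_basis j x \<partial>unit_interval) = (if i = j then 1 else 0)"
proof -
  define p where "p = int (i div 2)"
  define q where "q = int (j div 2)"
  have rp: "real (i div 2) = real_of_int p" and rq: "real (j div 2) = real_of_int q"
    by (simp_all add: p_def q_def)
  have cs: "(\<integral>x. cos (2 * pi * real_of_int m * x) * sin (2 * pi * real_of_int n * x) \<partial>unit_interval) = 0"
    for m n :: int
    using integral_sin_cos[of n m] by (simp add: mult.commute)
  have 1: "trig_basis 1 = (\<lambda>x. cos (2 * pi * real_of_int 0 * x))"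
    by (auto simp: trig_basis_def)
  have e: "trig_basis l = (\<lambda>x. sqrt 2 * cos (2 * pi * real (l div 2) * x))" if "even l" for l
    using that by (auto simp: trig_basis_def fun_eq_iff)
  have o: "trig_basis l = (\<lambda>x. sqrt 2 * sin (2 * pi * real (l div 2) * x))" if "odd l" "l \<noteq> 1" for l
    using that by (auto simp: trig_basis_def fun_eq_iff)
  have s: "sqrt 2 * a * (sqrt 2 * b) = 2 * (a * b)" for a b :: real
    by (simp add: algebra_simps)
  have ne: "l div 2 \<noteq> 0" if "1 \<le> l" "l \<noteq> 1" for l :: nat
    using that by presburger
  consider "i = 1" | "i \<noteq> 1" "even i" | "i \<noteq> 1" "odd i" by blast
  then show ?thesis
  proof cases
    case 1
    consider "j = 1" | "j \<noteq> 1" "even j" | "j \<noteq> 1" "odd j" by blast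
    then show ?thesis
    proof cases
      case 1
      then show ?thesis using \<open>i = 1\<close> integral_cos_cos[of 0 0]
        by (simp add: \<open>trig_basis 1 = _\<close>[simplified])
    next
      case 2
      then show ?thesis using \<open>i = 1\<close> integral_cos_unit_interval[of q] ne[of j] assms
        by (simp add: \<open>trig_basis 1 = _\<close>[simplified] e q_def)
    next
      case 3
      then show ?thesis using \<open>i = 1\<close> integral_sin_unit_interval[of q] ne[of j] assms
        by (simp add: \<open>trig_basis 1 = _\<close>[simplified] o q_def)
    qed
  next
    case 2
    consider "j = 1" | "j \<noteq> 1" "even j" | "j \<noteq> 1" "odd j" by blast
    then show ?thesis
    proof cases
      case 1
      then show ?thesis using 2 integral_cos_unit_interval[of p] ne[of i] assms
        by (simp add: \<open>trig_basis 1 = _\<close>[simplified] e p_def)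
    next
      case 22: 2
      \<comment> \<open>Both frequencies are nonnegative and \<open>p\<close> is nonzero, so p = -q
        is impossible and only the resonance p = q contributes. Equal parity makes p = q equivalent
        to i = j.\<close>
      have "p \<noteq> 0" "0 \<le> p" "0 \<le> q" "p = q \<longleftrightarrow> i = j"
        using 2 22 ne[of i] assms by (auto simp: p_def q_def elim!: evenE)
      have "(\<lambda>x. trig_basis i x * trig_basis j x)
        = (\<lambda>x. 2 * (cos (2 * pi * real_of_int p * x) * cos (2 * pi * real_of_int q * x)))"
        using 2 22 by (simp add: e s rp rq fun_eq_iff del: of_int_of_nat_eq)
      then show ?thesis
        using \<open>p \<noteq> 0\<close> \<open>0 \<le> p\<close> \<open>0 \<le> q\<close> \<open>p = q \<longleftrightarrow> i = j\<close>
        by (auto simp: integral_cos_cos)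
    next
      case 3
      then show ?thesis using 2 cs[of p q] by (auto simp add: e o s p_def q_def)
    qed
  next
    case 3
    consider "j = 1" | "j \<noteq> 1" "even j" | "j \<noteq> 1" "odd j" by blast
    then show ?thesis
    proof cases
      case 1
      then show ?thesis using 3 integral_sin_unit_interval[of p] ne[of i] assms
        by (simp add: \<open>trig_basis 1 = _\<close>[simplified] o p_def)
    next
      case 2
      then show ?thesis using 3 integral_sin_cos[of p q] by (auto simp add: e o s p_def q_def)
    next
      case 33: 3
      have "p \<noteq> 0" "0 \<le> p" "0 \<le> q" "p = q \<longleftrightarrow> i = j"
        using 3 33 ne[of i] assms by (auto simp: p_def q_def elim!: oddE)
      have "(\<lambda>x. trig_basis i x * trig_basis j x)
        = (\<lambda>x. 2 * (sin (2 * pi * real_of_int p * x) * sin (2 * pi * real_of_int q * x)))"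
        using 3 33 by (simp add: o s rp rq fun_eq_iff del: of_int_of_nat_eq)
      then show ?thesis
        using \<open>p \<noteq> 0\<close> \<open>0 \<le> p\<close> \<open>0 \<le> q\<close> \<open>p = q \<longleftrightarrow> i = j\<close>
        by (auto simp: integral_sin_sin)
    qed
  qed
qed

section \<open>Uniqueness of trigonometric coefficients for integrable functions\<close>

lemma integrable_times_continuous_unit_interval:
  fixes h p :: "real \<Rightarrow> real"
  assumes h: "integrable unit_interval h" and p: "continuous_on UNIV p"
  shows "integrable unit_interval (\<lambda>x. h x * p x)"
proof -
  have "compact (p ` {0..1})"
    by (rule compact_continuous_image[OF continuous_on_subset[OF p]]) auto
  then obtain K where K: "\<And>x. x \<in> {0..1} \<Longrightarrow> norm (p x) \<le> K"
    by (meson bounded_iff compact_imp_bounded imageI)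
  have [measurable]: "p \<in> borel_measurable unit_interval" "h \<in> borel_measurable unit_interval"
    using borel_measurable_continuous_onI[OF p] h by (auto intro: measurable_restrict_space1)
  show ?thesis
  proof (rule Bochner_Integration.integrable_bound)
    show "integrable unit_interval (\<lambda>x. K * h x)" using h by simp
    show "AE x in unit_interval. norm (h x * p x) \<le> norm (K * h x)"
    proof (rule AE_I2)
      fix x assume "x \<in> space unit_interval"
      then have "\<bar>p x\<bar> \<le> K" using K by (auto simp: space_restrict_space)
      then have "\<bar>h x\<bar> * \<bar>p x\<bar> \<le> \<bar>h x\<bar> * \<bar>K\<bar>" by (intro mult_left_mono) auto
      then show "norm (h x * p x) \<le> norm (K * h x)" by (simp add: abs_mult mult.commute)
    qed
  qed simp
qed

text \<open>The class \<open>A\<close> of functions \<open>p\<close> for which \<open>h \<cdot> p\<close> is orthogonal to the trigonometric system is closed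
  under multiplication by polynomials in \<open>cos (2 \<pi> x)\<close> and \<open>sin (2 \<pi> x)\<close>, products included, which avoids
  writing such polynomials as trigonometric sums.\<close>

lemma integral_times_real_polynomial_cis_eq_0:
  fixes h :: "real \<Rightarrow> real" and q :: "complex \<Rightarrow> real"
  assumes h: "integrable unit_interval h"
    and cos0: "\<And>m::int. (\<integral>x. h x * cos (2 * pi * real_of_int m * x) \<partial>unit_interval) = 0"
    and sin0: "\<And>m::int. (\<integral>x. h x * sin (2 * pi * real_of_int m * x) \<partial>unit_interval) = 0"
    and q: "real_polynomial_function q"
  shows "(\<integral>x. h x * q (cis (2 * pi * x)) \<partial>unit_interval) = 0"
proof -
  define c where "c m x = cos (2 * pi * real_of_int m * x)" for m x
  define s where "s m x = sin (2 * pi * real_of_int m * x)" for m x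
  define A where "A p \<longleftrightarrow> continuous_on UNIV p \<and>
    (\<forall>m. (\<integral>x. h x * (p x * c m x) \<partial>unit_interval) = 0 \<and>
         (\<integral>x. h x * (p x * s m x) \<partial>unit_interval) = 0)" for p :: "real \<Rightarrow> real"
  have cont [continuous_intros]: "continuous_on UNIV (c m)" "continuous_on UNIV (s m)" for m
    unfolding c_def s_def by (auto intro!: continuous_intros)
  have add: "(\<integral>x. h x * (u x + v x) \<partial>unit_interval)
      = (\<integral>x. h x * u x \<partial>unit_interval) + (\<integral>x. h x * v x \<partial>unit_interval)"
    if "continuous_on UNIV u" "continuous_on UNIV v" for u v :: "real \<Rightarrow> real"
    using integrable_times_continuous_unit_interval[OF h that(1)]
      integrable_times_continuous_unit_interval[OF h that(2)]
    by (simp add: distrib_left)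
  have scale: "(\<integral>x. h x * (a * u x) \<partial>unit_interval) = a * (\<integral>x. h x * u x \<partial>unit_interval)"
    for a and u :: "real \<Rightarrow> real"
    by (subst integral_mult_right_zero[symmetric]) (simp add: mult_ac)
  have A_add: "A (\<lambda>x. u x + v x)" if "A u" "A v" for u v
    using that add[of "\<lambda>x. u x * c _ x" "\<lambda>x. v x * c _ x"] add[of "\<lambda>x. u x * s _ x" "\<lambda>x. v x * s _ x"]
    unfolding A_def by (auto intro!: continuous_intros simp: distrib_right)
  have A_scale: "A (\<lambda>x. a * u x)" if "A u" for a u
    using that scale[of a "\<lambda>x. u x * c _ x"] scale[of a "\<lambda>x. u x * s _ x"]
    unfolding A_def by (auto intro!: continuous_intros simp: mult.assoc)
  have product_to_sum: "c 1 x * c m x = 1/2 * c (m - 1) x + 1/2 * c (m + 1) x"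
      "c 1 x * s m x = 1/2 * s (m + 1) x + 1/2 * s (m - 1) x"
      "s 1 x * c m x = 1/2 * s (m + 1) x + (-1/2) * s (m - 1) x"
      "s 1 x * s m x = 1/2 * c (m - 1) x + (-1/2) * c (m + 1) x" for m x
    by (simp_all add: c_def s_def algebra_simps cos_add cos_diff sin_add sin_diff)
  have lin: "(\<integral>x. h x * (u x * w x) \<partial>unit_interval) = 0"
    if "A u" "\<And>x. w x = a * v1 x + b * v2 x" "v1 \<in> range c \<union> range s" "v2 \<in> range c \<union> range s"
    for u w v1 v2 a b
  proof -
    have "(\<integral>x. h x * (u x * v x) \<partial>unit_interval) = 0" "continuous_on UNIV v" if "v \<in> range c \<union> range s" for v
      using that \<open>A u\<close> by (auto simp: A_def intro: cont)
    note this[OF that(3)] this[OF that(4)]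
    moreover have "u x * w x = a * (u x * v1 x) + b * (u x * v2 x)" for x
      by (simp add: that(2) algebra_simps)
    moreover have "continuous_on UNIV u" using \<open>A u\<close> by (simp add: A_def)
    ultimately show ?thesis
      using add[of "\<lambda>x. a * (u x * v1 x)" "\<lambda>x. b * (u x * v2 x)"]
        scale[of a "\<lambda>x. u x * v1 x"] scale[of b "\<lambda>x. u x * v2 x"]
      by (simp add: continuous_intros)
  qed
  have A_c: "A (\<lambda>x. u x * c 1 x)" and A_s: "A (\<lambda>x. u x * s 1 x)" if "A u" for u
    unfolding A_def using that lin[OF that product_to_sum(1)] lin[OF that product_to_sum(2)] 
       lin[OF that product_to_sum(3)] lin[OF that product_to_sum(4)]
    by (auto simp: A_def mult.assoc intro!: continuous_intros)
  have mult: "A (\<lambda>x. u x * q (cis (2 * pi * x)))" if "A u" for u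
    using q that
  \<comment> \<open>Generalizing over \<open>u\<close> serves the product case: the hypothesis for
    the second factor is applied to \<open>u\<close> times the first one.\<close>
  proof (induction q arbitrary: u rule: real_polynomial_function.induct)
    case (linear q)
    note Au = \<open>A u\<close>
    interpret bounded_linear q by fact
    have "q (cis (2 * pi * x)) = c 1 x * q 1 + s 1 x * q \<i>" for x
    proof -
      have "cis (2 * pi * x) = c 1 x *\<^sub>R 1 + s 1 x *\<^sub>R \<i>"
        by (simp add: complex_eq_iff c_def s_def)
      then show ?thesis by (simp only: add scaleR real_scaleR_def)
    qed
    then have "(\<lambda>x. u x * q (cis (2 * pi * x))) = (\<lambda>x. q 1 * (u x * c 1 x) + q \<i> * (u x * s 1 x))"
      by (simp add: algebra_simps)
    then show ?case
      using A_add[OF A_scale[OF A_c[OF Au]] A_scale[OF A_s[OF Au]]] by simp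
  next
    case (const a)
    then show ?case using A_scale[of u a] by (simp add: mult.commute)
  next
    case (add q1 q2)
    then show ?case using A_add by (simp add: distrib_left)
  next
    case (mult q1 q2)
    then show ?case by (simp flip: mult.assoc)
  qed
  have "A (\<lambda>_. 1)"
    using cos0 sin0 by (simp add: A_def c_def s_def)
  \<comment> \<open>Frequency 0 recovers the plain integral, as \<open>c 0\<close> is constantly
    1.\<close>
  from mult[OF this] have "(\<integral>x. h x * (q (cis (2 * pi * x)) * c 0 x) \<partial>unit_interval) = 0"
    by (simp add: A_def)
  then show ?thesis by (simp add: c_def)
qed

text \<open>A polynomial within e of \<open>F\<close> on the unit circle changes the integral by at
  most e times the L1 norm of \<open>h\<close>, so uniform approximation is strong enough for a
  merely integrable \<open>h\<close>.\<close>

lemma integral_times_continuous_cis_eq_0: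
  fixes h :: "real \<Rightarrow> real" and F :: "complex \<Rightarrow> real"
  assumes h: "integrable unit_interval h"
    and poly: "\<And>q :: complex \<Rightarrow> real. real_polynomial_function q \<Longrightarrow>
      (\<integral>x. h x * q (cis (2 * pi * x)) \<partial>unit_interval) = 0"
    and F: "continuous_on UNIV F"
  shows "(\<integral>x. h x * F (cis (2 * pi * x)) \<partial>unit_interval) = 0"
proof -
  let ?I = "\<integral>x. \<bar>h x\<bar> \<partial>unit_interval"
  have cis: "continuous_on UNIV (\<lambda>x. q (cis (2 * pi * x)))" if "continuous_on UNIV q" for q :: "complex \<Rightarrow> real"
    by (rule continuous_on_compose2[OF that]) (auto intro!: continuous_intros)
  have "\<bar>\<integral>x. h x * F (cis (2 * pi * x)) \<partial>unit_interval\<bar> \<le> e * ?I" if "e > 0" for e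
  proof -
    obtain q where q: "real_polynomial_function q" "\<And>z. z \<in> sphere 0 1 \<Longrightarrow> \<bar>F z - q z\<bar> < e"
      using Stone_Weierstrass_real_polynomial_function[of "sphere 0 1 :: complex set" F e]
        continuous_on_subset[OF F] \<open>e > 0\<close> by auto
    have qc: "continuous_on UNIV q"
      using q(1) continuous_on_polymonial_function real_polynomial_function_eq by blast
    have i1: "integrable unit_interval (\<lambda>x. h x * F (cis (2 * pi * x)))"
      "integrable unit_interval (\<lambda>x. h x * q (cis (2 * pi * x)))"
      by (rule integrable_times_continuous_unit_interval[OF h cis], fact)+
    have "(\<integral>x. h x * F (cis (2 * pi * x)) \<partial>unit_interval)
      = (\<integral>x. h x * F (cis (2 * pi * x)) - h x * q (cis (2 * pi * x)) \<partial>unit_interval)"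
      using i1 poly[OF q(1)] by simp
    also have "\<bar>\<dots>\<bar> \<le> (\<integral>x. e * \<bar>h x\<bar> \<partial>unit_interval)"
    proof (rule integral_abs_bound_integral)
      show "\<bar>h x * F (cis (2 * pi * x)) - h x * q (cis (2 * pi * x))\<bar> \<le> e * \<bar>h x\<bar>" for x
        using mult_left_mono[OF less_imp_le[OF q(2)[of "cis (2 * pi * x)"]], of "\<bar>h x\<bar>"]
        by (simp only: right_diff_distrib[symmetric] abs_mult mult.commute[of e]) simp
    qed (use i1 h in auto)
    finally show ?thesis by simp
  qed
  note * = this
  have "\<bar>\<integral>x. h x * F (cis (2 * pi * x)) \<partial>unit_interval\<bar> \<le> 0"
  proof (rule field_le_epsilon)
    fix e :: real assume "e > 0"
    have "0 \<le> ?I" by simp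
    \<comment> \<open>The summand 1 avoids a division by zero when \<open>h\<close> vanishes almost
      everywhere.\<close>
    have "\<bar>\<integral>x. h x * F (cis (2 * pi * x)) \<partial>unit_interval\<bar> \<le> e / (1 + ?I) * ?I"
      using \<open>0 < e\<close> \<open>0 \<le> ?I\<close> by (intro * divide_pos_pos add_pos_nonneg) auto
    also have "\<dots> \<le> e"
      using \<open>0 < e\<close> by (simp add: pos_divide_le_eq add_pos_nonneg algebra_simps)
    finally show "\<bar>\<integral>x. h x * F (cis (2 * pi * x)) \<partial>unit_interval\<bar> \<le> 0 + e" by simp
  qed
  then show ?thesis by simp
qed

text \<open>The difference x - y is an integer strictly between -1 and 1. Keeping one point in the
  open interval excludes the collision of 0 with 1.\<close>

lemma cis_2pi_eq_imp_eq:
  assumes "cis (2 * pi * x) = cis (2 * pi * y)" "0 < x" "x < 1" "0 \<le> y" "y \<le> 1"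
  shows "x = y"
proof -
  have "cis (2 * pi * (x - y)) = 1"
    using assms(1) by (simp add: right_diff_distrib cis_divide[symmetric])
  then have "cos (2 * pi * (x - y)) = 1" by (metis cis.sel(1) one_complex.sel(1))
  then obtain m :: int where "2 * pi * (x - y) = m * 2 * pi"
    by (auto simp: cos_one_2pi_int)
  then have "x - y = m" by simp
  with assms(2-) have "m = 0" by linarith
  with \<open>x - y = m\<close> show ?thesis by simp
qed

text \<open>The indicator of the compact image \<open>C\<close> of \<open>K\<close> on the circle is
  the decreasing limit of continuous bumps in the distance to \<open>C\<close>, and dominated
  convergence applies with majorant |h|. Pulled back to the interval, this indicator can differ from
  that of \<open>K\<close> only at the endpoints.\<close>

lemma set_integral_closed_eq_0:
  fixes h :: "real \<Rightarrow> real" and K :: "real set"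
  assumes h: "integrable unit_interval h"
    and cont: "\<And>F :: complex \<Rightarrow> real. continuous_on UNIV F \<Longrightarrow>
      (\<integral>x. h x * F (cis (2 * pi * x)) \<partial>unit_interval) = 0"
    and K: "closed K"
  shows "(\<integral>x. indicator K x * h x \<partial>unit_interval) = 0"
proof (cases "K \<inter> {0..1} = {}")
  \<comment> \<open>Treated apart because \<open>infdist\<close> to the empty set is 0 by
    convention, which would make the bumps below constantly 1.\<close>
  case True
  then have "(\<integral>x. indicator K x * h x \<partial>unit_interval) = (\<integral>x. 0 \<partial>unit_interval)"
    by (intro Bochner_Integration.integral_cong) (auto simp: space_restrict_space split: split_indicator)
  then show ?thesis by simp
next
  case False
  define C where "C = (\<lambda>x. cis (2 * pi * x)) ` (K \<inter> {0..1})"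
  have "compact (K \<inter> {0..1})" using K by (simp add: closed_Int_compact)
  then have "compact C"
    unfolding C_def by (intro compact_continuous_image continuous_intros)
  then have C: "closed C" "C \<noteq> {}" using False by (auto simp: C_def compact_imp_closed)
  define F where "F n z = max 0 (1 - real n * infdist z C)" for n and z :: complex
  have Fc: "continuous_on UNIV (F n)" for n
    unfolding F_def by (intro continuous_intros)
  have lim: "(\<lambda>n. F n z) \<longlonglongrightarrow> indicator C z" for z
  proof (cases "z \<in> C")
    case True then show ?thesis by (simp add: F_def)
  next
    case False
    then have "infdist z C > 0" using C by (simp add: infdist_pos_not_in_closed)
    then obtain N :: nat where "1 / infdist z C < N" using reals_Archimedean2 by blast
    then have "F n z = 0" if "n \<ge> N" for n
    proof -
      have "1 < real N * infdist z C"
        using \<open>1 / infdist z C < N\<close> \<open>infdist z C > 0\<close> by (simp add: field_simps)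
      also have "\<dots> \<le> real n * infdist z C" using that \<open>infdist z C > 0\<close> by simp
      finally show ?thesis by (simp add: F_def)
    qed
    then have "eventually (\<lambda>n. F n z = indicator C z) sequentially"
      using False by (auto simp: eventually_sequentially)
    then show ?thesis by (rule tendsto_eventually)
  qed
  have [measurable]: "h \<in> borel_measurable unit_interval" using h by simp
  have cis: "continuous_on UNIV (\<lambda>x. q (cis (2 * pi * x)))" if "continuous_on UNIV q" for q :: "complex \<Rightarrow> real"
    by (rule continuous_on_compose2[OF that]) (auto intro!: continuous_intros)
  have [measurable]: "(\<lambda>x. h x * F n (cis (2 * pi * x))) \<in> borel_measurable unit_interval" for n
    using integrable_times_continuous_unit_interval[OF h cis[OF Fc]] by simp
  have Cm [measurable]: "(\<lambda>x. h x * indicator C (cis (2 * pi * x))) \<in> borel_measurable unit_interval"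
    by (rule borel_measurable_LIMSEQ_real[where u="\<lambda>n x. h x * F n (cis (2 * pi * x))"])
       (auto intro!: tendsto_intros lim)
  have "(\<lambda>n. \<integral>x. h x * F n (cis (2 * pi * x)) \<partial>unit_interval)
      \<longlonglongrightarrow> (\<integral>x. h x * indicator C (cis (2 * pi * x)) \<partial>unit_interval)"
  proof (rule integral_dominated_convergence[where w="\<lambda>x. \<bar>h x\<bar>"])
    show "AE x in unit_interval. norm (h x * F n (cis (2 * pi * x))) \<le> \<bar>h x\<bar>" for n
    proof (rule AE_I2)
      fix x
      have "\<bar>F n (cis (2 * pi * x))\<bar> \<le> 1" by (auto simp: F_def infdist_nonneg)
      then show "norm (h x * F n (cis (2 * pi * x))) \<le> \<bar>h x\<bar>"
        by (simp add: abs_mult mult_left_le)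
    qed
  qed (use h in \<open>auto intro!: tendsto_intros lim\<close>)
  then have 0: "(\<integral>x. h x * indicator C (cis (2 * pi * x)) \<partial>unit_interval) = 0"
    by (simp add: cont[OF Fc] LIMSEQ_const_iff)
  have "AE x in lborel. x \<noteq> (0::real)" "AE x in lborel. x \<noteq> (1::real)"
    by (rule AE_lborel_singleton)+
  then have "AE x in unit_interval. x \<noteq> 0" "AE x in unit_interval. x \<noteq> 1"
    by (auto simp: AE_restrict_space_iff)
  then have "AE x in unit_interval. indicator K x * h x = h x * indicator C (cis (2 * pi * x))"
    using AE_space
  proof eventually_elim
    case (elim x)
    then have x: "0 < x" "x < 1" by (auto simp: space_restrict_space)
    have "cis (2 * pi * x) \<in> C \<longleftrightarrow> x \<in> K"
      using x cis_2pi_eq_imp_eq[of x] by (fastforce simp: C_def)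
    then show ?case by (auto split: split_indicator)
  qed
  moreover have "indicator K \<in> borel_measurable unit_interval"
    using K by (intro measurable_restrict_space1) simp
  ultimately have "(\<integral>x. indicator K x * h x \<partial>unit_interval)
      = (\<integral>x. h x * indicator C (cis (2 * pi * x)) \<partial>unit_interval)"
    by (intro integral_cong_AE Cm borel_measurable_times) (use h in auto)
  with 0 show ?thesis by simp
qed

text \<open>Closed sets form an intersection-stable generator of the Borel sets, so vanishing set
  integrals extend to all Borel sets by a Dynkin argument; \<open>h\<close> then has the same set
  integrals as 0.\<close>

lemma AE_eq_0_if_trig_coeff_eq_0:
  assumes h: "integrable unit_interval h" and coeff: "\<And>j. 1 \<le> j \<Longrightarrow> trig_coeff h j = 0"
  shows "AE x in unit_interval. h x = 0"
proof -
  have cosn: "(\<integral>x. h x * cos (2 * pi * real m * x) \<partial>unit_interval) = 0" for m :: nat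
  proof (cases "m = 0")
    case True
    then show ?thesis using coeff[of 1] by (simp add: trig_coeff_def trig_basis_def)
  next
    case False
    then have "sqrt 2 * (\<integral>x. h x * cos (2 * pi * real m * x) \<partial>unit_interval) = 0"
      using coeff[of "2 * m"]
      by (subst integral_mult_right_zero[symmetric]) (auto simp add: trig_coeff_def trig_basis_def mult_ac)
    then show ?thesis by simp
  qed
  have sinn: "(\<integral>x. h x * sin (2 * pi * real m * x) \<partial>unit_interval) = 0" for m :: nat
  proof (cases "m = 0")
    case False
    then have "sqrt 2 * (\<integral>x. h x * sin (2 * pi * real m * x) \<partial>unit_interval) = 0"
      using coeff[of "2 * m + 1"]
      by (subst integral_mult_right_zero[symmetric]) (auto simp add: trig_coeff_def trig_basis_def mult_ac)
    then show ?thesis by simp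
  qed simp
  have "(\<integral>x. h x * cos (2 * pi * real_of_int m * x) \<partial>unit_interval) = 0"
    "(\<integral>x. h x * sin (2 * pi * real_of_int m * x) \<partial>unit_interval) = 0" for m :: int
    \<comment> \<open>Negative frequencies reduce to positive ones because cosine is even and sine
      is odd.\<close>
    using cosn[of "nat \<bar>m\<bar>"] sinn[of "nat \<bar>m\<bar>"] by (cases "m \<ge> 0"; simp)+
  note poly = integral_times_real_polynomial_cis_eq_0[OF h this]
  have closed: "(\<integral>x. indicator K x * h x \<partial>unit_interval) = 0" if "closed K" for K
    using h _ that by (rule set_integral_closed_eq_0)
      (rule integral_times_continuous_cis_eq_0[OF h poly])
  have borel: "(\<integral>x. indicator B x * h x \<partial>unit_interval) = 0" if "B \<in> sets borel" for B
  proof -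
    have ind: "indicator S \<in> borel_measurable unit_interval" if "S \<in> sets borel" for S :: "real set"
      using that by (intro measurable_restrict_space1) simp
    have int: "integrable unit_interval (\<lambda>x. indicator S x * h x)" if "S \<in> sets borel" for S :: "real set"
      by (rule Bochner_Integration.integrable_bound[OF h])
        (use h ind[OF that] borel_measurable_times[OF ind[OF that], of h] in \<open>auto split: split_indicator\<close>)
    have "Int_stable (Collect closed :: real set set)" "Collect closed \<subseteq> Pow (UNIV :: real set)"
      "B \<in> sigma_sets UNIV (Collect closed)"
      using that by (auto simp: Int_stable_def borel_eq_closed)
    then show ?thesis
    proof (induction rule: sigma_sets_induct_disjoint)
      case (compl A)
      have A: "A \<in> sets borel" using compl(1) by (auto simp: borel_eq_closed)
      have "(\<integral>x. indicator (UNIV - A) x * h x \<partial>unit_interval) = (\<integral>x. h x - indicator A x * h x \<partial>unit_interval)"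
        by (intro Bochner_Integration.integral_cong) (auto split: split_indicator)
      also have "\<dots> = 0"
        using closed[of UNIV] compl(2) h int[OF A] by simp
      finally show ?case .
    next
      case (union D)
      \<comment> \<open>Countable additivity speaks of measurable sets of the restricted space, so
        the Borel sets are cut down to the interval.\<close>
      define E where "E i = D i \<inter> {0..1}" for i
      have D: "D i \<in> sets borel" for i
        using union(2) by (auto simp: borel_eq_closed)
      have eq: "(\<integral>x\<in>S \<inter> {0..1}. h x \<partial>unit_interval) = (\<integral>x. indicator S x * h x \<partial>unit_interval)" for S
        unfolding set_lebesgue_integral_def
        by (intro Bochner_Integration.integral_cong) (auto simp: space_restrict_space split: split_indicator)
      have "(\<integral>x\<in>(\<Union>i. E i). h x \<partial>unit_interval) = (\<Sum>i. \<integral>x\<in>E i. h x \<partial>unit_interval)"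
      proof (rule lebesgue_integral_countable_add)
        show Em: "E i \<in> sets unit_interval" for i
          using D[of i] by (auto simp: E_def sets_restrict_space)
        show "E i \<inter> E j = {}" if "i \<noteq> j" for i j
          using union(1) that by (auto simp: E_def disjoint_family_on_def)
        show "set_integrable unit_interval (\<Union>i. E i) h"
          unfolding set_integrable_def using Em h by (intro integrable_mult_indicator) auto
      qed
      also have "\<dots> = 0" by (simp add: E_def eq union(3))
      also have "(\<Union>i. E i) = (\<Union>i. D i) \<inter> {0..1}" by (auto simp: E_def)
      finally show ?case by (simp only: eq)
    qed (auto intro: closed)
  qed
  show ?thesis
  proof (rule density_unique_real[OF h])
    fix A :: "real set" assume "A \<in> sets unit_interval"
    then have "A \<in> sets borel" by (auto simp: sets_restrict_space)
    from borel[OF this] show "(\<integral>x\<in>A. h x \<partial>unit_interval) = (\<integral>x\<in>A. 0 \<partial>unit_interval)"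
      by (simp add: set_lebesgue_integral_def)
  qed simp
qed

section \<open>Series expansion and truncation error in the Sobolev class\<close>

lemma sobolev_class_weighted_sum:
  assumes f: "f \<in> sobolev_class \<beta> r" and r: "0 \<le> r"
  shows "summable (\<lambda>i. real (Suc i) powr (2 * \<beta>) * (trig_coeff f (Suc i))\<^sup>2)"
    and "(\<Sum>i. real (Suc i) powr (2 * \<beta>) * (trig_coeff f (Suc i))\<^sup>2) \<le> r\<^sup>2"
proof -
  let ?a = "\<lambda>i. real (Suc i) powr (2 * \<beta>) * (trig_coeff f (Suc i))\<^sup>2"
  have le: "(\<Sum>i. ennreal (?a i)) \<le> ennreal (r\<^sup>2)"
    using f by (simp add: sobolev_class_def)
  then have "(\<Sum>i. ennreal (?a i)) \<noteq> top"
    by (auto simp: top_unique)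
  then show "summable ?a" by (intro summable_suminf_not_top) auto
  then have "ennreal (\<Sum>i. ?a i) \<le> ennreal (r\<^sup>2)"
    using le by (subst suminf_ennreal2[symmetric]) auto
  then show "(\<Sum>i. ?a i) \<le> r\<^sup>2" by simp
qed

text \<open>Splitting |t| as (a |t|) (1/a) with weight a = i^\<beta> bounds it by a^2 t^2 + a^(-2).
  The first part is summable by the Sobolev condition, the second because 2\<beta> > 1.\<close>

lemma summable_abs_trig_coeff:
  assumes f: "f \<in> sobolev_class \<beta> r" and r: "0 \<le> r" and \<beta>: "\<beta> > 1 / 2"
  shows "summable (\<lambda>i. \<bar>trig_coeff f (Suc i)\<bar>)"
proof (rule summable_comparison_test')
  have "summable (\<lambda>n. real n powr (- 2 * \<beta>))"
    using \<beta> by (subst summable_real_powr_iff) simp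
  then have "summable (\<lambda>i. real (Suc i) powr (- 2 * \<beta>))"
    by (subst summable_Suc_iff)
  then show "summable (\<lambda>i. real (Suc i) powr (2 * \<beta>) * (trig_coeff f (Suc i))\<^sup>2
      + real (Suc i) powr (- 2 * \<beta>))"
    using sobolev_class_weighted_sum(1)[OF f r] by (rule summable_add[rotated])
  show "norm \<bar>trig_coeff f (Suc i)\<bar> \<le> real (Suc i) powr (2 * \<beta>) * (trig_coeff f (Suc i))\<^sup>2
      + real (Suc i) powr (- 2 * \<beta>)" for i
  proof -
    define a where "a = real (Suc i) powr \<beta>"
    define t where "t = \<bar>trig_coeff f (Suc i)\<bar>"
    have a: "a > 0" and "0 \<le> t" by (simp_all add: a_def t_def)
    have "t * 1 = (a * t) * (1 / a)" using a by simp
    also have "\<dots> \<le> (a * t)\<^sup>2 + (1 / a)\<^sup>2"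
      using sum_squares_bound[of "a * t" "1 / a"] \<open>0 \<le> t\<close> a by simp
    finally have "t \<le> a\<^sup>2 * t\<^sup>2 + inverse (a\<^sup>2)"
      by (simp add: power_mult_distrib power_divide divide_simps)
    moreover have "a\<^sup>2 = real (Suc i) powr (2 * \<beta>)"
      by (simp add: a_def power2_eq_square powr_add[symmetric])
    ultimately show ?thesis by (simp add: t_def powr_minus)
  qed
qed

lemma sobolev_class_expansion:
  assumes f: "f \<in> sobolev_class \<beta> r" and r: "0 \<le> r" and \<beta>: "\<beta> > 1 / 2"
  shows "AE x in unit_interval. (\<lambda>N. \<Sum>i<N. trig_coeff f (Suc i) * trig_basis (Suc i) x) \<longlonglongrightarrow> f x"
proof -
  define \<theta> where "\<theta> i = trig_coeff f (Suc i)" for i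
  define g where "g x = (\<Sum>i. \<theta> i * trig_basis (Suc i) x)" for x
  have sum\<theta>: "summable (\<lambda>i. \<bar>\<theta> i\<bar>)"
    using summable_abs_trig_coeff[OF f r \<beta>] by (simp add: \<theta>_def)
  have fint: "integrable unit_interval f" using f by (simp add: sobolev_class_def)
  have int_norm: "(\<integral>x. norm (u x) \<partial>unit_interval) \<le> K"
    if "continuous_on {0..1} u" "\<And>x. \<bar>u x\<bar> \<le> K" for u :: "real \<Rightarrow> real" and K
  proof -
    have "(\<integral>x. norm (u x) \<partial>unit_interval) \<le> (\<integral>x. K \<partial>unit_interval)"
      using that by (intro integral_mono continuous_integrable_unit_interval continuous_intros) auto
    also have "\<dots> = K"
      using integral_unit_interval_FTC[of "\<lambda>x. K * x" "\<lambda>_. K"] by (auto intro!: derivative_eq_intros)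
    finally show ?thesis .
  qed
  \<comment> \<open>This gives the majorant for termwise integration when the series is multiplied
    by one more basis function to compute its coefficients.\<close>
  have sq2: "\<bar>trig_basis i x * trig_basis j x\<bar> \<le> 2" for i j x
    using mult_mono[OF abs_trig_basis_le[of i x] abs_trig_basis_le[of j x]] by (simp add: abs_mult)
  have summ: "summable (\<lambda>i. \<bar>\<theta> i * trig_basis (Suc i) x\<bar>)" for x
    by (rule summable_comparison_test'[OF summable_mult[OF sum\<theta>, of "sqrt 2"]])
      (use abs_trig_basis_le in \<open>auto simp: abs_mult mult.commute intro!: mult_left_mono\<close>)
  have gint: "integrable unit_interval g"
    unfolding g_def
  proof (rule integrable_suminf)
    show "summable (\<lambda>i. \<integral>x. norm (\<theta> i * trig_basis (Suc i) x) \<partial>unit_interval)"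
    proof (rule summable_comparison_test'[OF summable_mult[OF sum\<theta>, of "sqrt 2"]])
      fix i :: nat
      have "(\<integral>x. norm (\<theta> i * trig_basis (Suc i) x) \<partial>unit_interval) \<le> sqrt 2 * \<bar>\<theta> i\<bar>"
        by (rule int_norm) (use abs_trig_basis_le in
          \<open>auto simp: abs_mult mult.commute intro!: mult_left_mono continuous_intros\<close>)
      then show "norm (\<integral>x. norm (\<theta> i * trig_basis (Suc i) x) \<partial>unit_interval) \<le> sqrt 2 * \<bar>\<theta> i\<bar>"
        by simp
    qed
  qed (use summ in \<open>auto intro!: continuous_integrable_unit_interval continuous_intros\<close>)
  have coeff: "trig_coeff g (Suc m) = \<theta> m" for m
  proof -
    have "trig_coeff g (Suc m)
        = (\<integral>x. (\<Sum>i. \<theta> i * trig_basis (Suc i) x * trig_basis (Suc m) x) \<partial>unit_interval)"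
      unfolding trig_coeff_def g_def
      by (intro Bochner_Integration.integral_cong refl suminf_mult2[OF summable_rabs_cancel[OF summ]])
    also have "\<dots> = (\<Sum>i. \<integral>x. \<theta> i * trig_basis (Suc i) x * trig_basis (Suc m) x \<partial>unit_interval)"
    proof (rule integral_suminf)
      show "AE x in unit_interval. summable (\<lambda>i. norm (\<theta> i * trig_basis (Suc i) x * trig_basis (Suc m) x))"
        using summable_mult2[OF summ] by (simp add: abs_mult)
      show "summable (\<lambda>i. \<integral>x. norm (\<theta> i * trig_basis (Suc i) x * trig_basis (Suc m) x) \<partial>unit_interval)"
      proof (rule summable_comparison_test'[OF summable_mult[OF sum\<theta>, of 2]])
        fix i :: nat
        have "(\<integral>x. norm (\<theta> i * trig_basis (Suc i) x * trig_basis (Suc m) x) \<partial>unit_interval) \<le> 2 * \<bar>\<theta> i\<bar>"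
        proof (rule int_norm)
          show "\<bar>\<theta> i * trig_basis (Suc i) x * trig_basis (Suc m) x\<bar> \<le> 2 * \<bar>\<theta> i\<bar>" for x
            using mult_right_mono[OF sq2[of "Suc i" x "Suc m"], of "\<bar>\<theta> i\<bar>"] by (simp add: abs_mult mult_ac)
        qed (auto intro!: continuous_intros)
        then show "norm (\<integral>x. norm (\<theta> i * trig_basis (Suc i) x * trig_basis (Suc m) x) \<partial>unit_interval) \<le> 2 * \<bar>\<theta> i\<bar>"
          by simp
      qed
    qed (auto intro!: continuous_integrable_unit_interval continuous_intros)
    also have "\<dots> = (\<Sum>i. if i = m then \<theta> i else 0)"
      using trig_basis_orthonormal by (intro suminf_cong) (simp add: mult.assoc)
    also have "\<dots> = \<theta> m"
      using sums_If_finite_set[of "{m}" \<theta>] by (simp add: sums_iff)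
    finally show ?thesis .
  qed
  have "AE x in unit_interval. f x - g x = 0"
  proof (rule AE_eq_0_if_trig_coeff_eq_0)
    show "integrable unit_interval (\<lambda>x. f x - g x)" using fint gint by simp
    fix j :: nat assume "1 \<le> j"
    then obtain m where j: "j = Suc m" by (cases j) auto
    have "integrable unit_interval (\<lambda>x. f x * trig_basis j x)" "integrable unit_interval (\<lambda>x. g x * trig_basis j x)"
      using fint gint by (auto intro!: integrable_times_continuous_unit_interval continuous_intros)
    then have "trig_coeff (\<lambda>x. f x - g x) j = trig_coeff f j - trig_coeff g j"
      by (simp add: trig_coeff_def left_diff_distrib)
    then show "trig_coeff (\<lambda>x. f x - g x) j = 0"
      using coeff[of m] by (simp add: j \<theta>_def)
  qed
  then show ?thesis
  proof eventually_elim
    case (elim x)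
    have "(\<lambda>N. \<Sum>i<N. \<theta> i * trig_basis (Suc i) x) \<longlonglongrightarrow> g x"
      unfolding g_def by (rule summable_LIMSEQ[OF summable_rabs_cancel[OF summ]])
    with elim show ?case by (simp add: \<theta>_def)
  qed
qed

lemma integral_trig_sum_squared:
  assumes "finite J" "J \<subseteq> {1..}"
  shows "(\<integral>x. (\<Sum>j\<in>J. b j * trig_basis j x)\<^sup>2 \<partial>unit_interval) = (\<Sum>j\<in>J. (b j)\<^sup>2)"
proof -
  have "(\<integral>x. (\<Sum>j\<in>J. b j * trig_basis j x)\<^sup>2 \<partial>unit_interval)
    = (\<integral>x. (\<Sum>i\<in>J. \<Sum>j\<in>J. b i * b j * (trig_basis i x * trig_basis j x)) \<partial>unit_interval)"
    by (simp add: power2_eq_square sum_product mult_ac)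
  also have "\<dots> = (\<Sum>i\<in>J. \<Sum>j\<in>J. b i * b j * (\<integral>x. trig_basis i x * trig_basis j x \<partial>unit_interval))"
    by (simp add: Bochner_Integration.integral_sum continuous_integrable_unit_interval continuous_intros)
  also have "\<dots> = (\<Sum>i\<in>J. \<Sum>j\<in>J. if j = i then b i * b j else 0)"
    using assms(2) by (intro sum.cong refl) (auto simp: trig_basis_orthonormal subset_iff)
  also have "\<dots> = (\<Sum>j\<in>J. (b j)\<^sup>2)"
    using assms(1) by (simp add: power2_eq_square)
  finally show ?thesis .
qed

text \<open>The error is almost everywhere the limit of finite trigonometric sums, whose norms are
  known exactly from orthonormality. Fatou's lemma carries a uniform bound on these norms over to
  the limit; square integrability of \<open>f\<close> comes out as a consequence.\<close>

lemma sq_L2_norm_trig_sum_le: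
  assumes f: "f \<in> sobolev_class \<beta> r" and r: "0 \<le> r" and \<beta>: "\<beta> > 1 / 2" and k: "1 \<le> k"
  shows "sq_L2_norm (\<lambda>x. (\<Sum>j=1..k. a j * trig_basis j x) - f x)
    \<le> ennreal ((\<Sum>j=1..k. (a j - trig_coeff f j)\<^sup>2) + r\<^sup>2 * real k powr (- 2 * \<beta>))"
proof -
  define \<theta> where "\<theta> = trig_coeff f"
  \<comment> \<open>The coefficients of the error: estimation error up to \<open>k\<close>, the
    negated coefficient of \<open>f\<close> beyond.\<close>
  define b where "b j = (if j \<le> k then a j else 0) - \<theta> j" for j
  define R where "R = (\<Sum>j=1..k. (a j - \<theta> j)\<^sup>2) + r\<^sup>2 * real k powr (- 2 * \<beta>)"
  let ?S = "\<lambda>N x. \<Sum>j=1..N. b j * trig_basis j x"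
  have S: "?S N x = (\<Sum>j=1..k. a j * trig_basis j x) - (\<Sum>i<N. \<theta> (Suc i) * trig_basis (Suc i) x)"
    if "k \<le> N" for N x
  proof -
    have "?S N x = (\<Sum>j=1..N. if j \<le> k then a j * trig_basis j x else 0) - (\<Sum>j=1..N. \<theta> j * trig_basis j x)"
      unfolding sum_subtractf[symmetric] by (rule sum.cong) (simp_all add: b_def left_diff_distrib)
    also have "(\<Sum>j=1..N. if j \<le> k then a j * trig_basis j x else 0) = (\<Sum>j=1..k. a j * trig_basis j x)"
      using that by (intro sum.mono_neutral_cong_right) auto
    also have "(\<Sum>j=1..N. \<theta> j * trig_basis j x) = (\<Sum>i<N. \<theta> (Suc i) * trig_basis (Suc i) x)"
      unfolding One_nat_def by (rule sum.atLeast1_atMost_eq)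
    finally show ?thesis .
  qed
  have tail: "(\<Sum>j=1..N. (b j)\<^sup>2) \<le> R" if "k \<le> N" for N
  proof -
    have "(\<Sum>j=1..N. (b j)\<^sup>2) = (\<Sum>j=1..k. (b j)\<^sup>2) + (\<Sum>j=k+1..N. (b j)\<^sup>2)"
      using sum.ub_add_nat[of 1 k "\<lambda>j. (b j)\<^sup>2" "N - k"] that k by simp
    also have "(\<Sum>j=1..k. (b j)\<^sup>2) = (\<Sum>j=1..k. (a j - \<theta> j)\<^sup>2)"
      by (intro sum.cong) (auto simp: b_def)
    also have "(\<Sum>j=k+1..N. (b j)\<^sup>2) \<le> (\<Sum>j=k+1..N. real k powr (- 2 * \<beta>) * (real j powr (2 * \<beta>) * (\<theta> j)\<^sup>2))"
    proof (rule sum_mono)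
      fix j assume j: "j \<in> {k+1..N}"
      \<comment> \<open>Beyond the cutoff the factor (j/k)^(2\<beta>) is at least 1, so inserting it
        turns the tail into a part of the Sobolev sum.\<close>
      have "1 = real k powr (- 2 * \<beta>) * real k powr (2 * \<beta>)"
        using k by (simp add: powr_add[symmetric])
      also have "\<dots> \<le> real k powr (- 2 * \<beta>) * real j powr (2 * \<beta>)"
        using j \<beta> by (intro mult_left_mono powr_mono2) auto
      finally have "1 * (\<theta> j)\<^sup>2 \<le> real k powr (- 2 * \<beta>) * real j powr (2 * \<beta>) * (\<theta> j)\<^sup>2"
        by (intro mult_right_mono) auto
      then show "(b j)\<^sup>2 \<le> real k powr (- 2 * \<beta>) * (real j powr (2 * \<beta>) * (\<theta> j)\<^sup>2)"
        using j by (simp add: b_def mult.assoc)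
    qed
    also have "\<dots> \<le> real k powr (- 2 * \<beta>) * (\<Sum>j=1..N. real j powr (2 * \<beta>) * (\<theta> j)\<^sup>2)"
      by (subst sum_distrib_left[symmetric]) (intro mult_left_mono sum_mono2; auto)
    also have "(\<Sum>j=1..N. real j powr (2 * \<beta>) * (\<theta> j)\<^sup>2)
        = (\<Sum>i<N. real (Suc i) powr (2 * \<beta>) * (\<theta> (Suc i))\<^sup>2)"
      unfolding One_nat_def by (rule sum.atLeast1_atMost_eq)
    also have "\<dots> \<le> (\<Sum>i. real (Suc i) powr (2 * \<beta>) * (\<theta> (Suc i))\<^sup>2)"
      using sobolev_class_weighted_sum(1)[OF f r] by (intro sum_le_suminf) (auto simp: \<theta>_def)
    also have "\<dots> \<le> r\<^sup>2" using sobolev_class_weighted_sum(2)[OF f r] by (simp add: \<theta>_def)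
    finally show ?thesis by (simp add: R_def mult.commute mult_right_mono)
  qed
  have "sq_L2_norm (\<lambda>x. (\<Sum>j=1..k. a j * trig_basis j x) - f x)
      = (\<integral>\<^sup>+x. liminf (\<lambda>N. ennreal ((?S N x)\<^sup>2)) \<partial>unit_interval)"
    unfolding sq_L2_norm_def
  proof (rule nn_integral_cong_AE)
    show "AE x in unit_interval. ennreal (((\<Sum>j=1..k. a j * trig_basis j x) - f x)\<^sup>2)
        = liminf (\<lambda>N. ennreal ((?S N x)\<^sup>2))"
      using sobolev_class_expansion[OF f r \<beta>]
    proof eventually_elim
      case (elim x)
      have "(\<lambda>N. (\<Sum>j=1..k. a j * trig_basis j x) - (\<Sum>i<N. \<theta> (Suc i) * trig_basis (Suc i) x))
          \<longlonglongrightarrow> (\<Sum>j=1..k. a j * trig_basis j x) - f x"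
        using elim by (intro tendsto_intros) (simp add: \<theta>_def)
      moreover have "eventually (\<lambda>N. (\<Sum>j=1..k. a j * trig_basis j x) - (\<Sum>i<N. \<theta> (Suc i) * trig_basis (Suc i) x)
          = ?S N x) sequentially"
        using S by (auto simp: eventually_sequentially intro!: exI[of _ k])
      ultimately have "(\<lambda>N. ?S N x) \<longlonglongrightarrow> (\<Sum>j=1..k. a j * trig_basis j x) - f x"
        by (rule Lim_transform_eventually)
      then have "(\<lambda>N. ennreal ((?S N x)\<^sup>2)) \<longlonglongrightarrow> ennreal (((\<Sum>j=1..k. a j * trig_basis j x) - f x)\<^sup>2)"
        by (intro tendsto_intros)
      then show ?case by (rule lim_imp_Liminf[OF sequentially_bot, symmetric])
    qed
  qed
  also have "\<dots> \<le> liminf (\<lambda>N. \<integral>\<^sup>+x. ennreal ((?S N x)\<^sup>2) \<partial>unit_interval)"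
    by (rule nn_integral_liminf) (auto intro!: measurable_restrict_space1)
  also have "\<dots> = liminf (\<lambda>N. ennreal (\<Sum>j=1..N. (b j)\<^sup>2))"
    by (subst nn_integral_eq_integral) (auto intro!: continuous_integrable_unit_interval continuous_intros simp: integral_trig_sum_squared)

  also have "\<dots> \<le> limsup (\<lambda>N. ennreal (\<Sum>j=1..N. (b j)\<^sup>2))"
    by (rule Liminf_le_Limsup) simp
  also have "\<dots> \<le> ennreal R"
    by (rule Limsup_bounded) (use tail in \<open>auto simp: eventually_sequentially intro!: exI[of _ k] ennreal_leI\<close>)
  finally show ?thesis by (simp add: R_def \<theta>_def)
qed

section \<open>The privacy mechanism\<close>

lemma central_binomial_sq_ge:
  assumes "1 \<le> m"
  shows "(16::real) ^ m \<le> 4 * real m * (real ((2 * m) choose m))\<^sup>2"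
  using assms
proof (induction m rule: nat_induct_at_least)
  case base
  then show ?case by (simp add: numeral_2_eq_2)
next
  case (Suc m)
  define b where "b = real ((2 * m) choose m)"
  define b' where "b' = real ((2 * Suc m) choose Suc m)"
  \<comment> \<open>Two absorption identities and the symmetry of the odd row combine to the
    recurrence \<open>rec\<close> between consecutive central binomials. The induction then rests on
    4m(m+1) \<le> (2m+1)^2.\<close>
  have 1: "Suc m * (Suc (Suc (2 * m)) choose Suc m) = Suc (Suc (2 * m)) * (Suc (2 * m) choose m)"
    by (rule Suc_times_binomial)
  have 2: "Suc m * (Suc (2 * m) choose Suc m) = Suc (2 * m) * ((2 * m) choose m)"
    by (rule Suc_times_binomial)
  have 3: "Suc (2 * m) choose m = Suc (2 * m) choose Suc m"
    using binomial_symmetric[of m "Suc (2 * m)"] by (simp add: mult_2)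
  have "Suc m * (Suc (Suc (2 * m)) choose Suc m) = 2 * (Suc (2 * m) * ((2 * m) choose m))"
    unfolding 1 2[symmetric] 3 by simp
  then have "real (Suc m * (Suc (Suc (2 * m)) choose Suc m)) = real (2 * (Suc (2 * m) * ((2 * m) choose m)))"
    by (rule arg_cong)
  then have rec: "(real m + 1) * b' = 2 * (2 * real m + 1) * b"
    unfolding b_def b'_def by (simp add: algebra_simps del: binomial_Suc_Suc)
  have "(real m + 1) * 16 ^ Suc m \<le> (real m + 1) * (16 * (4 * real m * b\<^sup>2))"
    using Suc.IH by (auto simp: b_def intro!: mult_left_mono)
  also have "\<dots> \<le> 16 * ((2 * real m + 1)\<^sup>2 * b\<^sup>2)"
  proof -
    have "4 * real m * (real m + 1) * b\<^sup>2 \<le> (2 * real m + 1)\<^sup>2 * b\<^sup>2"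
      by (intro mult_right_mono) (auto simp: power2_eq_square algebra_simps)
    then show ?thesis by (simp add: algebra_simps)
  qed
  also have "\<dots> = 4 * ((real m + 1) * b')\<^sup>2"
    unfolding rec by (simp add: power2_eq_square algebra_simps)
  also have "\<dots> = (real m + 1) * (4 * (real m + 1) * b'\<^sup>2)"
    by (simp add: power2_eq_square)
  finally show ?case
    by (simp add: b'_def add.commute)
qed

text \<open>With the central binomial b = binom(2m, m), the constant is 4^m / b for k = 2m+1 and 4^m
  / b + 1 for k = 2m, hence of order sqrt k. The factor 16 is generous enough to cover both
  parities.\<close>

lemma C_const_pos_and_sq_le:
  assumes k: "1 \<le> k"
  shows "0 < C_const k" and "(C_const k)\<^sup>2 \<le> 16 * real k"
proof -
  have "0 < C_const k \<and> (C_const k)\<^sup>2 \<le> 16 * real k"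
  proof (cases "odd k")
    case True
    then obtain m where m: "k = 2 * m + 1" by (elim oddE)
    define b where "b = real ((2 * m) choose m)"
    have b: "b > 0" by (simp add: b_def)
    have pow: "(2::real) ^ (2 * m) = 4 ^ m" by (simp add: power_mult)
    have C: "C_const k = 4 ^ m / b"
      by (simp add: C_const_def m b_def pow)
    have "16 ^ m \<le> 16 * real k * b\<^sup>2"
    proof (cases "m = 0")
      case False
      then have "16 ^ m \<le> 4 * real m * b\<^sup>2"
        using central_binomial_sq_ge[of m] by (simp add: b_def)
      also have "\<dots> \<le> 16 * real k * b\<^sup>2" by (intro mult_right_mono) (auto simp: m)
      finally show ?thesis .
    qed (simp add: m b_def)
    then have "(C_const k)\<^sup>2 \<le> 16 * real k"
      using b by (simp add: C power_divide power_mult[symmetric] mult.commute[of m] divide_le_eq)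
        (simp add: power_mult)
    then show ?thesis using b C by simp
  next
    case False
    then obtain m where m: "k = 2 * m" by (auto elim: evenE)
    with k have m1: "1 \<le> m" by simp
    then obtain l where l: "m = Suc l" by (cases m) auto
    define b where "b = real ((2 * m) choose m)"
    have b: "b > 0" by (simp add: b_def)
    have "(2 * m) choose m = (Suc (2 * l) choose Suc l) + (Suc (2 * l) choose l)"
      by (simp add: l)
    moreover have "Suc (2 * l) choose l = Suc (2 * l) choose Suc l"
      using binomial_symmetric[of l "Suc (2 * l)"] by (simp add: mult_2)
    ultimately have "(2 * m) choose m = 2 * ((2 * m - 1) choose m)"
      by (simp add: l del: binomial_Suc_Suc)
    then have half: "real ((2 * m - 1) choose m) = b / 2" by (simp add: b_def)
    have C: "C_const k = (4 ^ m + b) / b"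
      using half by (simp add: C_const_def m power_mult flip: b_def)
    have "b \<le> 4 ^ m"
    proof -
      have "(2 * m) choose m \<le> 2 ^ (2 * m)" by (rule binomial_le_pow2)
      then have "real ((2 * m) choose m) \<le> real (2 ^ (2 * m))" by (rule of_nat_mono)
      then show ?thesis by (simp add: b_def power_mult)
    qed
    then have "(4 ^ m + b)\<^sup>2 \<le> (2 * 4 ^ m)\<^sup>2" using b by (intro power_mono) auto
    also have "\<dots> = 4 * 16 ^ m" by (simp add: power_mult_distrib power2_eq_square flip: power_mult_distrib)
    also have "\<dots> \<le> 4 * (4 * real m * b\<^sup>2)"
      using central_binomial_sq_ge[OF m1] by (simp add: b_def)
    also have "\<dots> \<le> 16 * real k * b\<^sup>2" using b by (simp add: m)
    finally have "(C_const k)\<^sup>2 \<le> 16 * real k"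
      using b by (simp add: C power_divide divide_le_eq)
    then show ?thesis using b C by (simp add: add_pos_pos)
  qed
  then show "0 < C_const k" "(C_const k)\<^sup>2 \<le> 16 * real k" by auto
qed

lemma B_const_pos:
  assumes "1 \<le> k" "0 < \<alpha>"
  shows "0 < B_const \<alpha> k"
  using assms C_const_pos_and_sq_le(1)[of k]
  by (simp add: B_const_def B0_def add_pos_pos)

text \<open>The constant is 512 = 2 * 16 * 16: 2 from \<open>B0\<close> squared, 16 k from
  \<open>C_const\<close> squared, and 16/\<alpha>^2 from the last factor, since e^\<alpha> + 1 \<le>
  4 and e^\<alpha> - 1 \<ge> \<alpha>.\<close>

lemma B_const_sq_le:
  assumes k: "1 \<le> k" and \<alpha>: "0 < \<alpha>" "\<alpha> < 1"
  shows "(B_const \<alpha> k)\<^sup>2 \<le> 512 * real k / \<alpha>\<^sup>2"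
proof -
  have "exp \<alpha> \<le> exp 1" using \<alpha> by simp
  then have "exp \<alpha> + 1 \<le> 4" using exp_le by linarith
  moreover have "\<alpha> \<le> exp \<alpha> - 1" using exp_ge_add_one_self[of \<alpha>] by linarith
  ultimately have "(exp \<alpha> + 1) / (exp \<alpha> - 1) \<le> 4 / \<alpha>"
    using \<alpha> by (intro frac_le) auto
  then have "((exp \<alpha> + 1) / (exp \<alpha> - 1))\<^sup>2 \<le> (4 / \<alpha>)\<^sup>2"
    using \<alpha> by (intro power_mono) (auto intro!: divide_nonneg_nonneg add_nonneg_nonneg)
  then have "(C_const k)\<^sup>2 * ((exp \<alpha> + 1) / (exp \<alpha> - 1))\<^sup>2 \<le> 16 * real k * (4 / \<alpha>)\<^sup>2"
    using C_const_pos_and_sq_le(2)[OF k] by (intro mult_mono) auto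
  then show ?thesis
    by (simp add: B_const_def B0_def power_mult_distrib power_divide)
qed

section \<open>Counting majority subsets: the combinatorial origin of \<open>C_const\<close>\<close>

lemma card_majority_subsets:
  fixes D :: "'a set"
  assumes D: "finite D"
  shows "2 * card {S. S \<subseteq> D \<and> card D \<le> 2 * card S} = 2 ^ card D + card {S. S \<subseteq> D \<and> 2 * card S = card D}"
proof -
  let ?U = "{S. S \<subseteq> D \<and> card D \<le> 2 * card S}"
  let ?L = "{S. S \<subseteq> D \<and> 2 * card S \<le> card D}"
  have fin: "finite ?U" "finite ?L" using D by auto
  have cD: "card (D - S) = card D - card S" "card S \<le> card D" if "S \<subseteq> D" for S
    using that D by (auto simp: card_Diff_subset finite_subset card_mono)
  \<comment> \<open>Complementation exchanges the two families; together they cover the power set,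
    and they overlap exactly in the ties.\<close>
  have "bij_betw (\<lambda>S. D - S) ?U ?L"
    by (rule bij_betw_byWitness[where f'="\<lambda>S. D - S"]) (use cD in \<open>auto simp: double_diff\<close>)
  then have "card ?U = card ?L" by (rule bij_betw_same_card)
  then have "2 * card ?U = card ?U + card ?L" by simp
  also have "\<dots> = card (?U \<union> ?L) + card (?U \<inter> ?L)"
    using fin by (rule card_Un_Int)
  also have "?U \<union> ?L = Pow D" by auto
  also have "?U \<inter> ?L = {S. S \<subseteq> D \<and> 2 * card S = card D}" by auto
  finally show ?thesis using D by (simp add: card_Pow)
qed

text \<open>A majority set without \<open>j\<close> cancels against the same set with
  \<open>j\<close> added. What remains are the sets that reach a majority only thanks to
  \<open>j\<close>, and their size without \<open>j\<close> is forced to be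
  \<open>(card D - 1) div 2\<close>.\<close>

lemma sum_sign_majority_subsets:
  fixes D :: "'a set"
  assumes D: "finite D" and j: "j \<in> D"
  shows "(\<Sum>S | S \<subseteq> D \<and> card D \<le> 2 * card S. if j \<in> S then 1 else - 1 :: real)
    = real ((card D - 1) choose ((card D - 1) div 2))"
proof -
  let ?U = "{S. S \<subseteq> D \<and> card D \<le> 2 * card S}"
  let ?A = "{T. T \<subseteq> D - {j} \<and> card D \<le> 2 * card T + 2}"
  let ?B = "{T. T \<subseteq> D - {j} \<and> card D \<le> 2 * card T}"
  have fin: "finite ?U" "finite ?A" "finite ?B" using D by auto
  have "bij_betw (insert j) ?A {S \<in> ?U. j \<in> S}"
  proof (rule bij_betw_byWitness[where f'="\<lambda>S. S - {j}"])
    show "insert j ` ?A \<subseteq> {S \<in> ?U. j \<in> S}"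
    proof
      fix S assume "S \<in> insert j ` ?A"
      then obtain T where T: "S = insert j T" "T \<subseteq> D - {j}" "card D \<le> 2 * card T + 2" by auto
      then have "card S = Suc (card T)"
        using D by (subst T(1), intro card_insert_disjoint) (auto intro: finite_subset)
      then show "S \<in> {S \<in> ?U. j \<in> S}" using T j by auto
    qed
    show "(\<lambda>S. S - {j}) ` {S \<in> ?U. j \<in> S} \<subseteq> ?A"
      using D by (auto simp: card_Diff_singleton)
  qed auto
  from bij_betw_same_card[OF this] have A: "card {S \<in> ?U. j \<in> S} = card ?A" ..
  have B: "{S \<in> ?U. j \<notin> S} = ?B" by auto
  have "?U \<inter> {S. j \<in> S} = {S \<in> ?U. j \<in> S}" "?U \<inter> - {S. j \<in> S} = {S \<in> ?U. j \<notin> S}"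
    by blast+
  then have "(\<Sum>S\<in>?U. if j \<in> S then 1 else - 1 :: real)
      = (\<Sum>S\<in>{S \<in> ?U. j \<in> S}. 1) + (\<Sum>S\<in>{S \<in> ?U. j \<notin> S}. - 1)"
    using sum.If_cases[OF fin(1), of "\<lambda>S. j \<in> S" "\<lambda>_. 1 :: real" "\<lambda>_. - 1"] by (simp only:)
  also have "\<dots> = real (card ?A) - real (card ?B)"
    using A B by simp
  also have "\<dots> = real (card (?A - ?B))"
  proof -
    have sub: "?B \<subseteq> ?A" by auto
    show ?thesis
      unfolding card_Diff_subset[OF fin(3) sub] using card_mono[OF fin(2) sub] by (rule of_nat_diff[symmetric])
  qed
  also have "?A - ?B = {T. T \<subseteq> D - {j} \<and> card T = (card D - 1) div 2}"
  proof -
    have "card D > 0" using D j by (auto simp: card_gt_0_iff)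
    then have "card D \<le> 2 * c + 2 \<and> \<not> card D \<le> 2 * c \<longleftrightarrow> c = (card D - 1) div 2" for c
      by presburger
    then show ?thesis by blast
  qed
  also have "card \<dots> = (card D - 1) choose ((card D - 1) div 2)"
    using D j by (subst n_subsets) auto
  finally show ?thesis .
qed

text \<open>For even \<open>k\<close> the sets of size k/2 are ties lying in both closed halves.
  They add the central binomial to the denominator, which explains why \<open>C_const\<close>
  distinguishes parities.\<close>

lemma mean_sign_majority_subsets:
  assumes j: "j \<in> {1..k}"
  shows "(\<Sum>S | S \<subseteq> {1..k} \<and> k \<le> 2 * card S. if j \<in> S then 1 else - 1 :: real)
      / real (card {S. S \<subseteq> {1..k} \<and> k \<le> 2 * card S}) = inverse (C_const k)"
proof -
  let ?U = "{S. S \<subseteq> {1..k} \<and> k \<le> 2 * card S}"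
  have U: "2 * card ?U = 2 ^ k + card {S. S \<subseteq> {1..k} \<and> 2 * card S = k}"
    using card_majority_subsets[of "{1..k}"] by simp
  have s: "(\<Sum>S\<in>?U. if j \<in> S then 1 else - 1 :: real) = real ((k - 1) choose ((k - 1) div 2))"
    using sum_sign_majority_subsets[of "{1..k}" j] j by simp
  show ?thesis
  proof (cases "odd k")
    case True
    then have "{S. S \<subseteq> {1..k} \<and> 2 * card S = k} = {}" by auto
    then have "2 * card ?U = 2 ^ k" using U by simp
    then have "card ?U = 2 ^ (k - 1)" using j by (cases k) auto
    then show ?thesis unfolding s using True by (simp add: C_const_def)
  next
    case False
    then obtain m where m: "k = 2 * m" by (auto elim: evenE)
    with j have "1 \<le> m" by auto
    have "card {S. S \<subseteq> {1..k} \<and> 2 * card S = k} = k choose m"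
      using n_subsets[of "{1..k}" m] m by (simp add: conj_commute)
    then have "real (2 * card ?U) = real (2 ^ k + (k choose m))" using U by simp
    then have U': "real (card ?U) = (2 ^ k + real (k choose m)) / 2" by simp
    \<comment> \<open>The counting argument yields binom(2m-1, m-1), the definition has binom(2m-1,
      m); they agree by symmetry.\<close>
    have "(k - 1) div 2 = (k - 1) - m" using m \<open>1 \<le> m\<close> by presburger
    then have "(k - 1) choose ((k - 1) div 2) = (k - 1) choose m"
      using binomial_symmetric[of m "k - 1"] m \<open>1 \<le> m\<close> by simp
    then show ?thesis unfolding s U' using False by (simp add: C_const_def m)
  qed
qed

section \<open>The uniform law on a half cube\<close>

lemma finite_half_cube: "finite (half_cube B k v t)"
  unfolding half_cube_def by (rule finite_subset[OF _ finite_PiE_dflt[of "{1..k}" "\<lambda>_. {- B, B}" 0]]) auto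

text \<open>A vertex of the cube is encoded by the set of coordinates in which its sign agrees with that
  of \<open>v\<close>; the half cube then consists of the sets with at least \<open>k / 2\<close> elements.\<close>

lemma bij_betw_half_cube:
  assumes B: "0 < B" and c: "0 < c" and v: "\<And>j. j \<in> {1..k} \<Longrightarrow> v j \<in> {- c, c}"
  shows "bij_betw (\<lambda>S j. if j \<in> {1..k} then B / c * v j * (if j \<in> S then 1 else - 1) else 0)
    {S. S \<subseteq> {1..k} \<and> k \<le> 2 * card S} (half_cube B k v True)"
proof -
  define \<phi> where "\<phi> S j = (if j \<in> {1..k} then B / c * v j * (if j \<in> S then 1 else - 1) else 0)"
    for S :: "nat set" and j :: nat
  let ?sg = "\<lambda>z. {j \<in> {1..k}. 0 < z j * v j}"
  have sign: "\<phi> S j * v j = B * c * (if j \<in> S then 1 else - 1)" if "j \<in> {1..k}" for S j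
  proof -
    have "v j * v j = c * c" using v[OF that] by auto
    moreover have "\<phi> S j * v j = B / c * (v j * v j) * (if j \<in> S then 1 else - 1)"
      using that by (simp add: \<phi>_def)
    ultimately show ?thesis using c by simp
  qed
  have pos: "0 < \<phi> S j * v j \<longleftrightarrow> j \<in> S" if "j \<in> {1..k}" for S j
    using mult_pos_pos[OF B c] unfolding sign[OF that] by auto
  \<comment> \<open>Each agreement contributes B c and each disagreement -B c, so the inner product
    is nonnegative precisely for majority sets.\<close>
  have inner: "(\<Sum>j=1..k. \<phi> S j * v j) = B * c * (2 * real (card S) - real k)" if "S \<subseteq> {1..k}" for S
  proof -
    have "(\<Sum>j=1..k. \<phi> S j * v j) = (\<Sum>j=1..k. B * c * (if j \<in> S then 1 else - 1))"
      by (intro sum.cong refl sign)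
    also have "\<dots> = B * c * (\<Sum>j=1..k. 2 * indicator S j - 1)"
      by (simp add: sum_distrib_left) (intro sum.cong; simp)
    also have "(\<Sum>j=1..k. 2 * indicator S j - 1) = 2 * real (card S) - real k"
    proof -
      have "(\<Sum>j=1..k. indicator S j) = (\<Sum>j\<in>S. 1 :: real)"
        using that by (intro sum.mono_neutral_cong_right) (auto split: split_indicator)
      then show ?thesis by (simp add: sum_subtractf sum_distrib_left[symmetric])
    qed
    finally show ?thesis .
  qed
  have in_cube: "\<phi> S \<in> PiE_dflt {1..k} 0 (\<lambda>_. {- B, B})" for S
    using v c by (fastforce simp: PiE_dflt_def \<phi>_def)
  have "bij_betw \<phi> {S. S \<subseteq> {1..k} \<and> k \<le> 2 * card S} (half_cube B k v True)"
  proof (rule bij_betw_byWitness[where f'="?sg"])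
    show "\<forall>S\<in>{S. S \<subseteq> {1..k} \<and> k \<le> 2 * card S}. ?sg (\<phi> S) = S"
      using pos by blast
    have sg: "\<phi> (?sg z) = z" if "z \<in> half_cube B k v True" for z
    proof
      fix j
      show "\<phi> (?sg z) j = z j"
      proof (cases "j \<in> {1..k}")
        case True
        then have "z j \<in> {- B, B}" "v j \<in> {- c, c}"
          using that v by (auto simp: half_cube_def PiE_dflt_def)
        then show ?thesis
          using True B c by (auto simp: \<phi>_def mult_less_0_iff)
      next
        case False
        then show ?thesis using that by (auto simp: \<phi>_def half_cube_def PiE_dflt_def)
      qed
    qed
    then show "\<forall>z\<in>half_cube B k v True. \<phi> (?sg z) = z" by blast
    show "\<phi> ` {S. S \<subseteq> {1..k} \<and> k \<le> 2 * card S} \<subseteq> half_cube B k v True"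
    proof (rule image_subsetI)
      fix S assume "S \<in> {S. S \<subseteq> {1..k} \<and> k \<le> 2 * card S}"
      then have S: "S \<subseteq> {1..k}" and "k \<le> 2 * card S" by auto
      then have "0 \<le> (\<Sum>j=1..k. \<phi> S j * v j)"
        using B c unfolding inner[OF S] by (intro mult_nonneg_nonneg) auto
      then show "\<phi> S \<in> half_cube B k v True"
        using in_cube by (simp add: half_cube_def)
    qed
    show "?sg ` half_cube B k v True \<subseteq> {S. S \<subseteq> {1..k} \<and> k \<le> 2 * card S}"
    proof
      fix S assume "S \<in> ?sg ` half_cube B k v True"
      then obtain z where z: "z \<in> half_cube B k v True" and S: "S = ?sg z" by blast
      have "S \<subseteq> {1..k}" by (auto simp: S)
      moreover have "0 \<le> (\<Sum>j=1..k. \<phi> S j * v j)"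
        using z sg[OF z] by (simp add: S half_cube_def)
      then have "k \<le> 2 * card S"
        using mult_pos_pos[OF B c] unfolding inner[OF \<open>S \<subseteq> {1..k}\<close>] by (simp add: zero_le_mult_iff)
      ultimately show "S \<in> {S. S \<subseteq> {1..k} \<and> k \<le> 2 * card S}" by blast
    qed
  qed
  then show ?thesis unfolding \<phi>_def .
qed

text \<open>Both halves are closed, so central symmetry exchanges them exactly, ties included; it
  reduces \<open>t = False\<close> to \<open>t = True\<close>.\<close>

lemma bij_betw_half_cube_uminus:
  "bij_betw (\<lambda>z j. - z j) (half_cube B k v True) (half_cube B k v False)"
  by (rule bij_betw_byWitness[where f'="\<lambda>z j. - z j"])
    (auto simp: half_cube_def PiE_dflt_def sum_negf)

text \<open>In the encoding by agreement sets a coordinate is B/c times \<open>v j\<close> times a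
  sign, and the mean of that sign over majority sets is the reciprocal of
  \<open>C_const k\<close>.\<close>

lemma mean_half_cube:
  assumes B: "0 < B" and c: "0 < c" and v: "\<And>j. j \<in> {1..k} \<Longrightarrow> v j \<in> {- c, c}"
    and j: "j \<in> {1..k}"
  shows "half_cube B k v t \<noteq> {}"
    and "(\<integral>z. z j \<partial>measure_pmf (pmf_of_set (half_cube B k v t)))
      = (if t then 1 else - 1) * (B / c * v j * inverse (C_const k))"
proof -
  let ?U = "{S. S \<subseteq> {1..k} \<and> k \<le> 2 * card S}"
  have bij: "bij_betw (\<lambda>S j. if j \<in> {1..k} then B / c * v j * (if j \<in> S then 1 else - 1) else 0)
    ?U (half_cube B k v True)"
    using B c v by (rule bij_betw_half_cube)
  have card_T: "card (half_cube B k v True) = card ?U"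
    using bij_betw_same_card[OF bij] by simp
  have card_F: "card (half_cube B k v t) = card ?U"
    using card_T bij_betw_same_card[OF bij_betw_half_cube_uminus[of B k v]] by (cases t) simp_all
  have "{1..k} \<in> ?U" "finite ?U" by simp_all
  then have "card ?U > 0" by (metis card_gt_0_iff empty_iff)
  then show ne: "half_cube B k v t \<noteq> {}" unfolding card_F[symmetric] card_gt_0_iff by blast
  have "(\<Sum>z\<in>half_cube B k v True. z j) = (\<Sum>S\<in>?U. B / c * v j * (if j \<in> S then 1 else - 1))"
    using j sum.reindex_bij_betw[OF bij, where g="\<lambda>z. z j"] by simp
  also have "\<dots> = B / c * v j * (\<Sum>S\<in>?U. if j \<in> S then 1 else - 1)"
    by (simp add: sum_distrib_left)
  finally have sum_T: "(\<Sum>z\<in>half_cube B k v True. z j) = \<dots>" .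
  have sum_F: "(\<Sum>z\<in>half_cube B k v False. z j) = - (\<Sum>z\<in>half_cube B k v True. z j)"
    using sum.reindex_bij_betw[OF bij_betw_half_cube_uminus[of B k v], where g="\<lambda>z. z j"]
    by (simp add: sum_negf)
  have "(\<integral>z. z j \<partial>measure_pmf (pmf_of_set (half_cube B k v t)))
      = (\<Sum>z\<in>half_cube B k v t. z j) / real (card ?U)"
    using ne finite_half_cube card_F by (simp add: integral_pmf_of_set)
  also have "\<dots> = (if t then 1 else - 1) * (B / c * v j * ((\<Sum>S\<in>?U. if j \<in> S then 1 else - 1) / real (card ?U)))"
    using sum_T sum_F by (cases t) simp_all
  finally show "(\<integral>z. z j \<partial>measure_pmf (pmf_of_set (half_cube B k v t)))
      = (if t then 1 else - 1) * (B / c * v j * inverse (C_const k))"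
    unfolding mean_sign_majority_subsets[OF j] .
qed

section \<open>Range and mean of one privatized observation\<close>

lemma vertex_prob_in_unit:
  "0 \<le> 1 / 2 + trig_basis j x / (2 * B0)" "1 / 2 + trig_basis j x / (2 * B0) \<le> 1"
  using abs_trig_basis_le[of j x] by (auto simp: B0_def field_simps abs_le_iff)

lemma privacy_mechanism_support:
  assumes k: "1 \<le> k" and \<alpha>: "0 < \<alpha>" and z: "z \<in> set_pmf (privacy_mechanism \<alpha> k x)"
  shows "z \<in> PiE_dflt {1..k} 0 (\<lambda>_. {- B_const \<alpha> k, B_const \<alpha> k})"
proof -
  obtain v t where v: "v \<in> set_pmf (Pi_pmf {1..k} 0 (\<lambda>j. map_pmf (\<lambda>b. if b then B0 else - B0)
        (bernoulli_pmf (1 / 2 + trig_basis j x / (2 * B0)))))"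
    and zt: "z \<in> set_pmf (pmf_of_set (half_cube (B_const \<alpha> k) k v t))"
    using z by (auto simp: privacy_mechanism_def)
  have "v j \<in> {- B0, B0}" if "j \<in> {1..k}" for j
    using v that by (auto simp: set_Pi_pmf PiE_dflt_def split: if_splits)
  \<comment> \<open>\<open>pmf_of_set\<close> denotes the uniform law only for finite nonempty sets,
    so this has to be secured before its support can be read off.\<close>
  then have "half_cube (B_const \<alpha> k) k v t \<noteq> {}"
    using k by (intro mean_half_cube(1)[where c=B0 and j=1] B_const_pos[OF k \<alpha>]) (auto simp: B0_def)
  with zt finite_half_cube have "z \<in> half_cube (B_const \<alpha> k) k v t" by simp
  then show ?thesis by (simp add: half_cube_def)
qed

lemma privacy_mechanism_abs_le:
  assumes "1 \<le> k" "0 < \<alpha>" "z \<in> set_pmf (privacy_mechanism \<alpha> k x)"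
  shows "\<bar>z j\<bar> \<le> B_const \<alpha> k"
  using privacy_mechanism_support[OF assms] B_const_pos[OF assms(1,2)]
  by (cases "j \<in> {1..k}") (auto simp: PiE_dflt_def)

text \<open>The random choice of the half shrinks the mean by (e^\<alpha> - 1)/(e^\<alpha> + 1),
  averaging over a half by 1/\<open>C_const k\<close>; \<open>B_const\<close> carries the inverses
  of both factors. What remains is the vertex coordinate, whose mean B0 (2p - 1) is the basis
  function.\<close>

lemma privacy_mechanism_mean:
  assumes \<alpha>: "0 < \<alpha>" and j: "j \<in> {1..k}"
  shows "(\<integral>z. z j \<partial>measure_pmf (privacy_mechanism \<alpha> k x)) = trig_basis j x"
proof -
  let ?V = "Pi_pmf {1..k} 0 (\<lambda>j. map_pmf (\<lambda>b. if b then B0 else - B0)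
        (bernoulli_pmf (1 / 2 + trig_basis j x / (2 * B0))))"
  let ?T = "bernoulli_pmf (exp \<alpha> / (exp \<alpha> + 1))"
  let ?B = "B_const \<alpha> k"
  have k: "1 \<le> k" using j by auto
  have B0: "B0 > 0" by (simp add: B0_def)
  have p: "0 \<le> exp \<alpha> / (exp \<alpha> + 1)" "exp \<alpha> / (exp \<alpha> + 1) \<le> 1"
    by (auto simp: divide_simps add_pos_pos)
  have finV: "finite (set_pmf ?V)"
    by (rule finite_subset[OF set_Pi_pmf_subset' finite_PiE_dflt]) auto
  have Vv: "v i \<in> {- B0, B0}" if "v \<in> set_pmf ?V" "i \<in> {1..k}" for v i
    using that by (auto simp: set_Pi_pmf PiE_dflt_def split: if_splits)
  have inner: "(\<integral>z. z j \<partial>measure_pmf (bind_pmf ?T (\<lambda>t. pmf_of_set (half_cube ?B k v t)))) = v j"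
    if v: "v \<in> set_pmf ?V" for v
  proof -
    have half: "half_cube ?B k v t \<noteq> {}"
      "(\<integral>z. z j \<partial>measure_pmf (pmf_of_set (half_cube ?B k v t)))
        = (if t then 1 else - 1) * (?B / B0 * v j * inverse (C_const k))" for t
      using mean_half_cube[OF B_const_pos[OF k \<alpha>] B0 _ j, of v t] Vv[OF v] by blast+
    have "(\<integral>z. z j \<partial>measure_pmf (bind_pmf ?T (\<lambda>t. pmf_of_set (half_cube ?B k v t))))
        = (\<Sum>t\<in>UNIV. pmf ?T t *\<^sub>R (\<integral>z. z j \<partial>measure_pmf (pmf_of_set (half_cube ?B k v t))))"
      by (rule pmf_expectation_bind) (auto simp: half finite_half_cube)
    also have "\<dots> = (2 * (exp \<alpha> / (exp \<alpha> + 1)) - 1) * (?B / B0 * v j * inverse (C_const k))"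
    proof -
      have "q * w + (1 - q) * (- w) = (2 * q - 1) * w" for q w :: real
        by (simp add: algebra_simps)
      from this[of "exp \<alpha> / (exp \<alpha> + 1)" "?B / B0 * v j * inverse (C_const k)"] show ?thesis
        unfolding half(2) using p by (simp add: UNIV_bool)
    qed
    also have "2 * (exp \<alpha> / (exp \<alpha> + 1)) - 1 = (exp \<alpha> - 1) / (exp \<alpha> + 1)"
      using add_pos_pos[OF exp_gt_zero[of \<alpha>] zero_less_one] by (simp add: field_simps)
    also have "(exp \<alpha> - 1) / (exp \<alpha> + 1) * (?B / B0 * v j * inverse (C_const k)) = v j"
    proof -
      have "exp \<alpha> - 1 \<noteq> 0" "exp \<alpha> + 1 \<noteq> 0" "C_const k \<noteq> 0"
        using \<alpha> exp_gt_zero[of \<alpha>] C_const_pos_and_sq_le(1)[OF k] by (auto simp del: exp_gt_zero)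
      \<comment> \<open>Here a and b stand for e^\<alpha> - 1 and e^\<alpha> + 1, c for
        \<open>C_const k\<close>, d for \<open>B0\<close> and w for the vertex coordinate.\<close>
      moreover have cancel: "a / b * (d * c * (b / a) / d * w * inverse c) = w"
        if "a \<noteq> 0" "b \<noteq> 0" "c \<noteq> 0" "d \<noteq> 0" for a b c d w :: real
        using that by simp
      ultimately show ?thesis
        unfolding B_const_def using B0 by (intro cancel) simp_all
    qed
    finally show ?thesis .
  qed
  have "(\<integral>z. z j \<partial>measure_pmf (privacy_mechanism \<alpha> k x))
      = (\<Sum>v\<in>set_pmf ?V. pmf ?V v *\<^sub>R
          (\<integral>z. z j \<partial>measure_pmf (bind_pmf ?T (\<lambda>t. pmf_of_set (half_cube ?B k v t)))))"
    unfolding privacy_mechanism_def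
  proof (rule pmf_expectation_bind[OF finV])
    fix v assume v: "v \<in> set_pmf ?V"
    have "half_cube ?B k v t \<noteq> {}" for t
      using mean_half_cube(1)[OF B_const_pos[OF k \<alpha>] B0 _ j, of v t] Vv[OF v] by blast
    then show "finite (set_pmf (bind_pmf ?T (\<lambda>t. pmf_of_set (half_cube ?B k v t))))"
      using finite_half_cube by (auto simp: set_bind_pmf)
  qed simp
  also have "\<dots> = (\<Sum>v\<in>set_pmf ?V. pmf ?V v *\<^sub>R v j)"
    using inner by (intro sum.cong) auto
  also have "\<dots> = (\<integral>v. v j \<partial>measure_pmf ?V)"
    by (rule integral_measure_pmf[symmetric, OF finV])
  also have "\<dots> = (\<integral>y. y \<partial>measure_pmf (map_pmf (\<lambda>v. v j) ?V))" by simp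
  also have "map_pmf (\<lambda>v. v j) ?V = map_pmf (\<lambda>b. if b then B0 else - B0)
        (bernoulli_pmf (1 / 2 + trig_basis j x / (2 * B0)))"
    using j by (subst Pi_pmf_component) auto
  \<comment> \<open>\<open>bernoulli_pmf\<close> clips its parameter to the unit interval; no
    clipping occurs because the basis functions are bounded by \<open>B0\<close>.\<close>
  also have "(\<integral>y. y \<partial>measure_pmf \<dots>) = trig_basis j x"
    using B0 vertex_prob_in_unit[of j x] by (simp add: field_simps)
  finally show ?thesis .
qed

text \<open>Variance plus squared bias around an arbitrary target \<open>c\<close>. The variables
  may have different means, as the private observations do once the data are fixed; the same bound
  later serves for the basis functions evaluated at the data.\<close>

lemma (in prob_space) mean_square_empirical_mean_le:
  fixes Y :: "nat \<Rightarrow> 'a \<Rightarrow> real"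
  assumes n: "0 < n" and indep: "indep_vars (\<lambda>_. borel) Y {..<n}"
    and bound: "\<And>i. i < n \<Longrightarrow> AE \<omega> in M. \<bar>Y i \<omega>\<bar> \<le> b"
  shows "integrable M (\<lambda>\<omega>. (1 / real n * (\<Sum>i<n. Y i \<omega>) - c)\<^sup>2)"
    and "expectation (\<lambda>\<omega>. (1 / real n * (\<Sum>i<n. Y i \<omega>) - c)\<^sup>2)
      \<le> b\<^sup>2 / real n + (1 / real n * (\<Sum>i<n. expectation (Y i)) - c)\<^sup>2"
proof -
  define \<mu> where "\<mu> i = expectation (Y i)" for i
  define D where "D i \<omega> = Y i \<omega> - \<mu> i" for i \<omega>
  define e where "e = 1 / real n * (\<Sum>i<n. \<mu> i) - c"
  have Ym [measurable]: "random_variable borel (Y i)" if "i < n" for i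
    using indep that by (simp add: indep_vars_def)
  have Yi: "integrable M (Y i)" if "i < n" for i
    using bound[OF that] Ym[OF that] by (intro integrable_const_bound[where B=b]) auto
  have Yi2: "integrable M (\<lambda>\<omega>. (Y i \<omega>)\<^sup>2)" if "i < n" for i
  proof (rule integrable_const_bound[where B="b\<^sup>2"])
    show "AE \<omega> in M. norm ((Y i \<omega>)\<^sup>2) \<le> b\<^sup>2"
      using bound[OF that] by eventually_elim (auto simp: abs_le_square_iff[symmetric])
  qed (use Ym[OF that] in measurable)
  have DD: "integrable M (\<lambda>\<omega>. D i \<omega> * D j \<omega>)
      \<and> expectation (\<lambda>\<omega>. D i \<omega> * D j \<omega>) \<le> (if i = j then b\<^sup>2 else 0)" if ij: "i < n" "j < n" for i j
  proof (cases "i = j")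
    case True
    have "expectation (\<lambda>\<omega>. D i \<omega> * D i \<omega>) = expectation (\<lambda>\<omega>. (Y i \<omega>)\<^sup>2 - 2 * \<mu> i * Y i \<omega> + (\<mu> i)\<^sup>2)"
      by (simp add: D_def power2_eq_square algebra_simps)
    also have "\<dots> = expectation (\<lambda>\<omega>. (Y i \<omega>)\<^sup>2) - (\<mu> i)\<^sup>2"
      using Yi[OF ij(1)] Yi2[OF ij(1)] by (simp add: prob_space \<mu>_def[symmetric] power2_eq_square)
    also have "expectation (\<lambda>\<omega>. (Y i \<omega>)\<^sup>2) \<le> expectation (\<lambda>_. b\<^sup>2)"
    proof (rule integral_mono_AE[OF Yi2[OF ij(1)]])
      show "AE \<omega> in M. (Y i \<omega>)\<^sup>2 \<le> b\<^sup>2"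
        using bound[OF ij(1)] by eventually_elim (auto simp: abs_le_square_iff[symmetric])
    qed simp
    finally have "expectation (\<lambda>\<omega>. D i \<omega> * D i \<omega>) \<le> b\<^sup>2 - (\<mu> i)\<^sup>2" by (simp add: prob_space)
    moreover have "integrable M (\<lambda>\<omega>. (Y i \<omega>)\<^sup>2 - 2 * \<mu> i * Y i \<omega> + (\<mu> i)\<^sup>2)"
      using Yi[OF ij(1)] Yi2[OF ij(1)] by simp
    then have "integrable M (\<lambda>\<omega>. D i \<omega> * D i \<omega>)"
      by (simp add: D_def power2_eq_square algebra_simps)
    ultimately show ?thesis using True by (simp add: order_trans)
  next
    case False
    have "indep_var borel (Y i) borel (Y j)"
      \<comment> \<open>Pairwise independence is obtained as independence of \<open>Y i\<close> from
        the sum over the singleton of \<open>j\<close>.\<close>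
      using indep_vars_sum[of "{j}" i Y] indep_vars_subset[OF indep, of "{i, j}"] ij False by simp
    from indep_var_compose[OF this, of "\<lambda>y. y - \<mu> i" borel "\<lambda>y. y - \<mu> j" borel]
    have ind: "indep_var borel (D i) borel (D j)" by (simp add: D_def[abs_def] comp_def)
    have D: "integrable M (D l)" "expectation (D l) = 0" if "l < n" for l
      using Yi[OF that] by (auto simp: D_def[abs_def] \<mu>_def prob_space)
    show ?thesis
      using indep_var_integrable[OF ind D(1)[OF ij(1)] D(1)[OF ij(2)]]
        indep_var_lebesgue_integral[OF ind D(1)[OF ij(1)] D(1)[OF ij(2)]] D(2)[OF ij(1)] False by simp
  qed
  have Di: "integrable M (D l)" "expectation (D l) = 0" if "l < n" for l
    using Yi[OF that] by (auto simp: D_def[abs_def] \<mu>_def prob_space)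
  \<comment> \<open>\<open>D\<close> is the centred part and \<open>e\<close> the bias, so the
    middle term has mean zero and the double sum keeps only its diagonal.\<close>
  have split: "(1 / real n * (\<Sum>i<n. Y i \<omega>) - c)\<^sup>2
    = (1 / real n)\<^sup>2 * (\<Sum>i<n. \<Sum>j<n. D i \<omega> * D j \<omega>) + 2 * e * (1 / real n) * (\<Sum>i<n. D i \<omega>) + e\<^sup>2" for \<omega>
  proof -
    have "(\<Sum>i<n. Y i \<omega>) = (\<Sum>i<n. D i \<omega>) + (\<Sum>i<n. \<mu> i)"
      by (simp add: D_def sum_subtractf)
    then have "1 / real n * (\<Sum>i<n. Y i \<omega>) - c = 1 / real n * (\<Sum>i<n. D i \<omega>) + e"
      by (simp add: e_def distrib_left)
    then show ?thesis
      by (simp only: power2_sum power_mult_distrib sum_product[symmetric] power2_eq_square[of "sum _ _"]) simp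
  qed
  have int: "integrable M (\<lambda>\<omega>. \<Sum>i<n. \<Sum>j<n. D i \<omega> * D j \<omega>)" "integrable M (\<lambda>\<omega>. \<Sum>i<n. D i \<omega>)"
    using DD Di by (auto intro!: Bochner_Integration.integrable_sum)
  show "integrable M (\<lambda>\<omega>. (1 / real n * (\<Sum>i<n. Y i \<omega>) - c)\<^sup>2)"
    unfolding split using int by simp
  have "expectation (\<lambda>\<omega>. \<Sum>i<n. D i \<omega>) = 0"
    using Di by (subst Bochner_Integration.integral_sum) auto
  then have eq: "expectation (\<lambda>\<omega>. (1 / real n * (\<Sum>i<n. Y i \<omega>) - c)\<^sup>2)
      = (1 / real n)\<^sup>2 * expectation (\<lambda>\<omega>. \<Sum>i<n. \<Sum>j<n. D i \<omega> * D j \<omega>) + e\<^sup>2"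
    unfolding split using int by (simp add: prob_space)
  have "expectation (\<lambda>\<omega>. \<Sum>i<n. \<Sum>j<n. D i \<omega> * D j \<omega>)
      = (\<Sum>i<n. \<Sum>j<n. expectation (\<lambda>\<omega>. D i \<omega> * D j \<omega>))"
    using DD by (subst Bochner_Integration.integral_sum) (auto intro!: Bochner_Integration.integral_sum sum.cong)
  also have "\<dots> \<le> (\<Sum>i<n. \<Sum>j<n. if i = j then b\<^sup>2 else 0)"
    using DD by (intro sum_mono) auto
  also have "\<dots> = real n * b\<^sup>2" by simp
  finally have "(1 / real n)\<^sup>2 * expectation (\<lambda>\<omega>. \<Sum>i<n. \<Sum>j<n. D i \<omega> * D j \<omega>) \<le> (1 / real n)\<^sup>2 * (real n * b\<^sup>2)"
    by (intro mult_left_mono) auto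
  also have "\<dots> = b\<^sup>2 / real n"
    using n by (simp add: power2_eq_square)
  finally show "expectation (\<lambda>\<omega>. (1 / real n * (\<Sum>i<n. Y i \<omega>) - c)\<^sup>2)
      \<le> b\<^sup>2 / real n + (1 / real n * (\<Sum>i<n. expectation (Y i)) - c)\<^sup>2"
    unfolding eq by (simp add: e_def \<mu>_def)
qed

section \<open>The risk of the projection estimator\<close>

text \<open>Restriction to \<open>I\<close> is the identity on the product space, so the joint law
  of the coordinates is the product of their laws, which characterizes independence.\<close>

lemma indep_vars_PiM_coordinates:
  assumes I: "finite I" "I \<noteq> {}" and P: "prob_space P"
  shows "prob_space.indep_vars (PiM I (\<lambda>_. P)) (\<lambda>_. P) (\<lambda>i \<omega>. \<omega> i) I"
proof -
  interpret prob_space "PiM I (\<lambda>_. P)" using P by (intro prob_space_PiM)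
  have "distr (PiM I (\<lambda>_. P)) (PiM I (\<lambda>_. P)) (\<lambda>x. \<lambda>i\<in>I. x i) = distr (PiM I (\<lambda>_. P)) (PiM I (\<lambda>_. P)) (\<lambda>x. x)"
    by (rule distr_cong) (auto simp: space_PiM PiE_def extensional_restrict)
  also have "\<dots> = PiM I (\<lambda>_. P)" by (rule distr_id)
  also have "\<dots> = PiM I (\<lambda>i. distr (PiM I (\<lambda>_. P)) P (\<lambda>x. x i))"
    using distr_PiM_component[of I "\<lambda>_. P"] P by (intro PiM_cong) simp_all
  finally show ?thesis
    using I by (subst indep_vars_iff_distr_eq_PiM') simp_all
qed

text \<open>The contaminated law is known through its values on sets; this passes the mixture
  formula on to integrals by induction on nonnegative measurable functions.\<close>

lemma nn_integral_linear_in_measure: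
  assumes sets: "sets N1 = sets M" "sets N2 = sets M"
    and em: "\<And>A. A \<in> sets M \<Longrightarrow> emeasure M A = a * emeasure N1 A + b * emeasure N2 A"
    and u: "u \<in> borel_measurable M"
  shows "(\<integral>\<^sup>+x. u x \<partial>M) = a * (\<integral>\<^sup>+x. u x \<partial>N1) + b * (\<integral>\<^sup>+x. u x \<partial>N2)"
  using u
proof (induction u rule: borel_measurable_induct)
  case (cong f g)
  have "space N1 = space M" "space N2 = space M" using sets by (auto dest: sets_eq_imp_space_eq)
  with cong(3) have "integral\<^sup>N M g = integral\<^sup>N M f" "integral\<^sup>N N1 g = integral\<^sup>N N1 f" "integral\<^sup>N N2 g = integral\<^sup>N N2 f"
    by (auto intro!: nn_integral_cong)
  with cong(4) show ?case by simp
next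
  case (set A)
  then show ?case using sets em by simp
next
  case (mult u c)
  have [measurable]: "u \<in> borel_measurable M" "u \<in> borel_measurable N1" "u \<in> borel_measurable N2"
    using mult(2) sets by (simp_all cong: measurable_cong_sets)
  show ?case using mult(4) by (simp add: nn_integral_cmult distrib_left mult_ac)
next
  case (add u v)
  have [measurable]: "u \<in> borel_measurable M" "u \<in> borel_measurable N1" "u \<in> borel_measurable N2"
    "v \<in> borel_measurable M" "v \<in> borel_measurable N1" "v \<in> borel_measurable N2"
    using add sets by (simp_all cong: measurable_cong_sets)
  show ?case using add by (simp add: nn_integral_add distrib_left add_ac)
next
  case (seq U)
  have m: "U i \<in> borel_measurable M" "U i \<in> borel_measurable N1" "U i \<in> borel_measurable N2" for i
    using seq(1) sets by (simp_all cong: measurable_cong_sets)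
  have inc: "incseq (\<lambda>i. integral\<^sup>N N (U i))" for N
    using seq(3) by (auto simp: incseq_def le_fun_def intro!: nn_integral_mono)
  have sup: "integral\<^sup>N N (Sup (range U)) = (SUP i. integral\<^sup>N N (U i))"
    if "\<And>i. U i \<in> borel_measurable N" for N
  proof -
    have "Sup (range U) = (\<lambda>x. SUP i. U i x)" by (simp add: fun_eq_iff image_comp)
    then show ?thesis using nn_integral_monotone_convergence_SUP[OF seq(3) that] by simp
  qed
  have "(SUP i. integral\<^sup>N M (U i)) = (SUP i. a * integral\<^sup>N N1 (U i) + b * integral\<^sup>N N2 (U i))"
    by (simp add: seq.IH)
  also have "\<dots> = (SUP i. a * integral\<^sup>N N1 (U i)) + (SUP i. b * integral\<^sup>N N2 (U i))"
    using inc by (intro ennreal_SUP_add) (auto simp: incseq_def mult_left_mono)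
  finally show ?case by (simp only: sup[OF m(1)] sup[OF m(2)] sup[OF m(3)] SUP_mult_left_ennreal)
qed

lemma contaminated_prob_and_mean:
  assumes \<epsilon>: "0 \<le> \<epsilon>" "\<epsilon> \<le> 1" and f: "f \<in> sobolev_class \<beta> r"
    and G: "prob_space G" "sets G = sets (restrict_space borel {0..1})"
  shows "prob_space (contaminated \<epsilon> f G)"
    and "(\<integral>x. trig_basis j x \<partial>contaminated \<epsilon> f G)
      = (1 - \<epsilon>) * trig_coeff f j + \<epsilon> * (\<integral>x. trig_basis j x \<partial>G)"
proof -
  let ?P = "contaminated \<epsilon> f G" and ?D = "density unit_interval (\<lambda>x. ennreal (f x))"
  have sU: "sets (restrict_space borel {0..1::real}) = sets unit_interval"
    by (simp add: sets_restrict_space)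
  have sets: "sets ?D = sets ?P" "sets G = sets ?P" by (simp_all add: sets_contaminated G(2) sU)
  have em: "emeasure ?P A = ennreal (1 - \<epsilon>) * emeasure ?D A + ennreal \<epsilon> * emeasure G A"
    if "A \<in> sets ?P" for A
    using that by (intro emeasure_contaminated) (simp_all add: G(2) sU sets_contaminated)
  have fint: "integrable unit_interval f" and f0: "\<And>x. x \<in> space unit_interval \<Longrightarrow> 0 \<le> f x"
    and f1: "(\<integral>x. f x \<partial>unit_interval) = 1"
    using f by (auto simp: sobolev_class_def space_restrict_space)
  have fm [measurable]: "f \<in> borel_measurable unit_interval" using fint by simp
  have D1: "prob_space ?D"
  proof
    have "emeasure ?D (space ?D) = (\<integral>\<^sup>+x. ennreal (f x) \<partial>unit_interval)"
    proof -
      have "emeasure ?D (space unit_interval)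
          = (\<integral>\<^sup>+x. ennreal (f x) * indicator (space unit_interval) x \<partial>unit_interval)"
        by (intro emeasure_density sets.top) measurable
      also have "\<dots> = (\<integral>\<^sup>+x. ennreal (f x) \<partial>unit_interval)"
        by (intro nn_integral_cong) simp
      finally show ?thesis by (simp only: space_density)
    qed
    also have "\<dots> = 1" using fint f0 f1 by (subst nn_integral_eq_integral) auto
    finally show "emeasure ?D (space ?D) = 1" .
  qed
  interpret D: prob_space ?D by fact
  interpret G: prob_space G by fact
  have sp: "space ?D = space ?P" "space G = space ?P" by (rule sets_eq_imp_space_eq[OF sets(1)], rule sets_eq_imp_space_eq[OF sets(2)])
  show "prob_space ?P"
  proof
    show "emeasure ?P (space ?P) = 1"
      unfolding em[OF sets.top] D.emeasure_space_1[unfolded sp(1)] G.emeasure_space_1[unfolded sp(2)]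
      using \<epsilon> by (simp flip: ennreal_plus)
  qed
  then interpret P: prob_space ?P .
  have \<phi>m [measurable]: "trig_basis j \<in> borel_measurable N" if "sets N = sets ?P" for N
  proof -
    have "sets N = sets (restrict_space borel {0..1})" using that by (simp add: sets_contaminated sU)
    from measurable_cong_sets[OF this refl] show ?thesis
      using measurable_restrict_space1[OF trig_basis_measurable, of j "{0..1}"] by blast
  qed
  have int: "integrable N (trig_basis j)" if "prob_space N" "sets N = sets ?P" for N
  proof -
    interpret prob_space N by fact
    show ?thesis using abs_trig_basis_le \<phi>m[OF that(2)] by (intro integrable_const_bound[where B="sqrt 2"]) auto
  qed
  \<comment> \<open>The mixture formula is available for nonnegative integrands only. The basis
    function is shifted by its bound, and the shift cancels in the end because the mixture weights
    sum to 1.\<close>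
  have nn: "(\<integral>\<^sup>+x. ennreal (trig_basis j x + sqrt 2) \<partial>N) = ennreal ((\<integral>x. trig_basis j x \<partial>N) + sqrt 2)"
    and pos: "0 \<le> (\<integral>x. trig_basis j x \<partial>N) + sqrt 2" if N: "prob_space N" "sets N = sets ?P" for N
  proof -
    interpret prob_space N by fact
    have nonneg: "0 \<le> trig_basis j x + sqrt 2" for x
      using abs_trig_basis_le[of j x] by (simp add: abs_le_iff)
    have eq: "(\<integral>x. trig_basis j x + sqrt 2 \<partial>N) = (\<integral>x. trig_basis j x \<partial>N) + sqrt 2"
      using int[OF N] by (simp add: prob_space)
    show "(\<integral>\<^sup>+x. ennreal (trig_basis j x + sqrt 2) \<partial>N) = ennreal ((\<integral>x. trig_basis j x \<partial>N) + sqrt 2)"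
      unfolding eq[symmetric] using int[OF N] nonneg by (intro nn_integral_eq_integral) auto
    show "0 \<le> (\<integral>x. trig_basis j x \<partial>N) + sqrt 2"
      unfolding eq[symmetric] using nonneg by simp
  qed
  have "ennreal ((\<integral>x. trig_basis j x \<partial>?P) + sqrt 2)
      = ennreal (1 - \<epsilon>) * ennreal ((\<integral>x. trig_basis j x \<partial>?D) + sqrt 2)
        + ennreal \<epsilon> * ennreal ((\<integral>x. trig_basis j x \<partial>G) + sqrt 2)"
    unfolding nn[OF P.prob_space_axioms refl, symmetric] nn[OF D1 sets(1), symmetric] nn[OF G(1) sets(2), symmetric]
    by (rule nn_integral_linear_in_measure[OF sets em], assumption)
      (intro measurable_compose[OF _ measurable_ennreal] borel_measurable_add \<phi>m[OF refl] borel_measurable_const)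
  also have "\<dots> = ennreal ((1 - \<epsilon>) * ((\<integral>x. trig_basis j x \<partial>?D) + sqrt 2) + \<epsilon> * ((\<integral>x. trig_basis j x \<partial>G) + sqrt 2))"
    using \<epsilon> pos[OF D1 sets(1)] pos[OF G(1) sets(2)]
    by (subst ennreal_plus) (auto simp: ennreal_mult)
  finally have "(\<integral>x. trig_basis j x \<partial>?P) + sqrt 2
      = (1 - \<epsilon>) * ((\<integral>x. trig_basis j x \<partial>?D) + sqrt 2) + \<epsilon> * ((\<integral>x. trig_basis j x \<partial>G) + sqrt 2)"
    using \<epsilon> pos[OF D1 sets(1)] pos[OF G(1) sets(2)] pos[OF P.prob_space_axioms refl]
    by (subst (asm) ennreal_inj) auto
  moreover have "(\<integral>x. trig_basis j x \<partial>?D) = trig_coeff f j"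
    using \<phi>m[of unit_interval] f0 fm sets_contaminated
    by (subst integral_density) (auto simp: trig_coeff_def AE_I2)
  ultimately show "(\<integral>x. trig_basis j x \<partial>?P) = (1 - \<epsilon>) * trig_coeff f j + \<epsilon> * (\<integral>x. trig_basis j x \<partial>G)"
    by (simp add: algebra_simps)
qed

lemma abs_integral_trig_basis_le:
  assumes "prob_space N"
  shows "\<bar>\<integral>x. trig_basis j x \<partial>N\<bar> \<le> sqrt 2"
proof -
  interpret prob_space N by fact
  show ?thesis
  proof (cases "integrable N (trig_basis j)")
    case True
    have "\<bar>\<integral>x. trig_basis j x \<partial>N\<bar> \<le> (\<integral>x. sqrt 2 \<partial>N)"
      using True abs_trig_basis_le by (intro integral_abs_bound_integral) auto
    then show ?thesis by (simp add: prob_space)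
  \<comment> \<open>A non-integrable function has Bochner integral 0 by convention.\<close>
  qed (simp add: not_integrable_integral_eq)
qed

lemma abs_trig_coeff_le:
  assumes "f \<in> sobolev_class \<beta> r"
  shows "\<bar>trig_coeff f j\<bar> \<le> sqrt 2"
proof -
  have fint: "integrable unit_interval f" and f0: "\<And>x. x \<in> space unit_interval \<Longrightarrow> 0 \<le> f x"
    and f1: "(\<integral>x. f x \<partial>unit_interval) = 1"
    using assms by (auto simp: sobolev_class_def space_restrict_space)
  have "\<bar>trig_coeff f j\<bar> \<le> (\<integral>x. sqrt 2 * f x \<partial>unit_interval)"
    unfolding trig_coeff_def
  proof (rule integral_abs_bound_integral)
    show "integrable unit_interval (\<lambda>x. f x * trig_basis j x)"
      by (intro integrable_times_continuous_unit_interval fint continuous_intros)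
    show "\<bar>f x * trig_basis j x\<bar> \<le> sqrt 2 * f x" if "x \<in> space unit_interval" for x
      using f0[OF that] mult_left_mono[OF abs_trig_basis_le[of j x], of "f x"] by (simp add: abs_mult mult.commute)
  qed (use fint in auto)
  then show ?thesis using f1 by simp
qed

text \<open>The bias is \<epsilon> times the difference of two coefficients of probability laws,
  each at most sqrt 2 in absolute value; 8 is the square of 2 sqrt 2. The bound is thus uniform in
  the contamination.\<close>

lemma contaminated_bias_sq_le:
  assumes \<epsilon>: "0 \<le> \<epsilon>" "\<epsilon> \<le> 1" and f: "f \<in> sobolev_class \<beta> r"
    and G: "prob_space G" "sets G = sets (restrict_space borel {0..1})"
  shows "((\<integral>x. trig_basis j x \<partial>contaminated \<epsilon> f G) - trig_coeff f j)\<^sup>2 \<le> 8 * \<epsilon>\<^sup>2"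
proof -
  define g where "g = (\<integral>x. trig_basis j x \<partial>G)"
  have "\<bar>g - trig_coeff f j\<bar> \<le> 2 * sqrt 2"
    using abs_integral_trig_basis_le[OF G(1), of j] abs_trig_coeff_le[OF f, of j] by (simp add: g_def abs_le_iff)
  then have "\<bar>g - trig_coeff f j\<bar>\<^sup>2 \<le> (2 * sqrt 2)\<^sup>2" by (intro power_mono) auto
  then have "(g - trig_coeff f j)\<^sup>2 \<le> 8" by (simp add: power_mult_distrib)
  then have "\<epsilon>\<^sup>2 * (g - trig_coeff f j)\<^sup>2 \<le> \<epsilon>\<^sup>2 * 8" by (intro mult_left_mono) auto
  moreover have "(\<integral>x. trig_basis j x \<partial>contaminated \<epsilon> f G) - trig_coeff f j = \<epsilon> * (g - trig_coeff f j)"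
    using contaminated_prob_and_mean(2)[OF \<epsilon> f G, of j] by (simp add: g_def algebra_simps)
  ultimately show ?thesis by (simp add: power_mult_distrib)
qed

text \<open>First averaging, with the data held fixed: the conditional mean is the non-private
  empirical coefficient, whose own deviation from \<open>c\<close> is left for the averaging over
  the data.\<close>

lemma mean_square_private_sample_le:
  assumes k: "1 \<le> k" and \<alpha>: "0 < \<alpha>" and n: "0 < n" and j: "j \<in> {1..k}"
  shows "integrable (measure_pmf (private_sample \<alpha> k n X)) (\<lambda>Z. (1 / real n * (\<Sum>i<n. Z i j) - c)\<^sup>2)"
    and "(\<integral>Z. (1 / real n * (\<Sum>i<n. Z i j) - c)\<^sup>2 \<partial>measure_pmf (private_sample \<alpha> k n X))
      \<le> (B_const \<alpha> k)\<^sup>2 / real n + (1 / real n * (\<Sum>i<n. trig_basis j (X i)) - c)\<^sup>2"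
proof -
  let ?M = "measure_pmf (private_sample \<alpha> k n X)"
  have indep: "prob_space.indep_vars ?M (\<lambda>_. borel) (\<lambda>i Z. Z i j) {..<n}"
    unfolding private_sample_def
    by (rule prob_space.indep_vars_compose2[OF measure_pmf.prob_space_axioms indep_vars_Pi_pmf]) auto
  have comp: "map_pmf (\<lambda>Z. Z i) (private_sample \<alpha> k n X) = privacy_mechanism \<alpha> k (X i)" if "i < n" for i
    using that by (simp add: private_sample_def Pi_pmf_component)
  have bound: "AE Z in ?M. \<bar>Z i j\<bar> \<le> B_const \<alpha> k" if "i < n" for i
  proof (rule AE_pmfI)
    fix Z assume "Z \<in> set_pmf (private_sample \<alpha> k n X)"
    then have "Z i \<in> set_pmf (privacy_mechanism \<alpha> k (X i))"
      unfolding comp[OF that, symmetric] by simp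
    then show "\<bar>Z i j\<bar> \<le> B_const \<alpha> k" by (rule privacy_mechanism_abs_le[OF k \<alpha>])
  qed
  have mean: "(\<integral>Z. Z i j \<partial>?M) = trig_basis j (X i)" if "i < n" for i
  proof -
    have "(\<integral>Z. Z i j \<partial>?M) = (\<integral>z. z j \<partial>measure_pmf (map_pmf (\<lambda>Z. Z i) (private_sample \<alpha> k n X)))"
      by simp
    then show ?thesis unfolding comp[OF that] privacy_mechanism_mean[OF \<alpha> j] .
  qed
  note ms = prob_space.mean_square_empirical_mean_le[OF measure_pmf.prob_space_axioms n indep bound, of c]
  show "integrable ?M (\<lambda>Z. (1 / real n * (\<Sum>i<n. Z i j) - c)\<^sup>2)" by (rule ms(1))
  show "(\<integral>Z. (1 / real n * (\<Sum>i<n. Z i j) - c)\<^sup>2 \<partial>?M)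
      \<le> (B_const \<alpha> k)\<^sup>2 / real n + (1 / real n * (\<Sum>i<n. trig_basis j (X i)) - c)\<^sup>2"
    using ms(2) mean by simp
qed

text \<open>Second averaging, over the data; 2 is the square of the bound sqrt 2 on the basis
  functions.\<close>

lemma mean_square_sample_le:
  assumes n: "0 < n" and P: "prob_space P" and meas: "trig_basis j \<in> borel_measurable P"
  shows "integrable (PiM {..<n} (\<lambda>_. P)) (\<lambda>X. (1 / real n * (\<Sum>i<n. trig_basis j (X i)) - c)\<^sup>2)"
    and "(\<integral>X. (1 / real n * (\<Sum>i<n. trig_basis j (X i)) - c)\<^sup>2 \<partial>PiM {..<n} (\<lambda>_. P))
      \<le> 2 / real n + ((\<integral>x. trig_basis j x \<partial>P) - c)\<^sup>2"
proof -
  let ?M = "PiM {..<n} (\<lambda>_. P)"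
  have M: "prob_space ?M" using P by (intro prob_space_PiM)
  have "prob_space.indep_vars ?M (\<lambda>_. P) (\<lambda>i \<omega>. \<omega> i) {..<n}"
    using n P by (intro indep_vars_PiM_coordinates) auto
  then have indep: "prob_space.indep_vars ?M (\<lambda>_. borel) (\<lambda>i X. trig_basis j (X i)) {..<n}"
    using meas by (rule prob_space.indep_vars_compose2[OF M])
  have bound: "AE X in ?M. \<bar>trig_basis j (X i)\<bar> \<le> sqrt 2" for i
    by (rule AE_I2) (rule abs_trig_basis_le)
  have mean: "(\<integral>X. trig_basis j (X i) \<partial>?M) = (\<integral>x. trig_basis j x \<partial>P)" if "i < n" for i
  proof -
    have "(\<integral>x. trig_basis j x \<partial>distr ?M P (\<lambda>X. X i)) = (\<integral>X. trig_basis j (X i) \<partial>?M)"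
      using that meas by (intro integral_distr) auto
    moreover have "distr ?M P (\<lambda>X. X i) = P"
      using distr_PiM_component[of "{..<n}" "\<lambda>_. P" i] P that by simp
    ultimately show ?thesis by simp
  qed
  note ms = prob_space.mean_square_empirical_mean_le[OF M n indep bound, of c]
  show "integrable ?M (\<lambda>X. (1 / real n * (\<Sum>i<n. trig_basis j (X i)) - c)\<^sup>2)" by (rule ms(1))
  show "(\<integral>X. (1 / real n * (\<Sum>i<n. trig_basis j (X i)) - c)\<^sup>2 \<partial>?M)
      \<le> 2 / real n + ((\<integral>x. trig_basis j x \<partial>P) - c)\<^sup>2"
    using ms(2) mean n by simp
qed

text \<open>The loss is majorized for every \<open>Z\<close> and then for every \<open>X\<close> by
  a finite sum of squares whose integrability is known. Monotonicity of the nonnegative integral is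
  then enough at both levels, and measurability of the loss itself never enters.\<close>

lemma private_risk_le:
  assumes \<beta>: "\<beta> > 1 / 2" and r: "0 \<le> r" and k: "1 \<le> k" and \<alpha>: "0 < \<alpha>" and n: "0 < n"
    and \<epsilon>: "0 \<le> \<epsilon>" "\<epsilon> \<le> 1" and f: "f \<in> sobolev_class \<beta> r"
    and G: "prob_space G" "sets G = sets (restrict_space borel {0..1})"
  shows "private_risk \<alpha> k n (contaminated \<epsilon> f G) f
    \<le> ennreal (real k * (((B_const \<alpha> k)\<^sup>2 + 2) / real n + 8 * \<epsilon>\<^sup>2) + r\<^sup>2 * real k powr (- 2 * \<beta>))"
proof -
  let ?P = "contaminated \<epsilon> f G"
  let ?M = "PiM {..<n} (\<lambda>_. ?P)"
  let ?Q = "\<lambda>X. measure_pmf (private_sample \<alpha> k n X)"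
  let ?\<theta> = "trig_coeff f"
  let ?tail = "r\<^sup>2 * real k powr (- 2 * \<beta>)"
  let ?zbar = "\<lambda>Z j. 1 / real n * (\<Sum>i<n. Z i j) :: real"
  let ?xbar = "\<lambda>X j. 1 / real n * (\<Sum>i<n. trig_basis j (X i))"
  note P = contaminated_prob_and_mean(1)[OF \<epsilon> f G]
  have M: "prob_space ?M" using P by (intro prob_space_PiM)
  have meas: "trig_basis j \<in> borel_measurable ?P" for j
  proof -
    have "sets ?P = sets (restrict_space borel {0..1})" by (simp add: sets_contaminated sets_restrict_space)
    from measurable_cong_sets[OF this refl] show ?thesis
      using measurable_restrict_space1[OF trig_basis_measurable, of j "{0..1}"] by blast
  qed
  have inner: "(\<integral>\<^sup>+Z. sq_L2_norm (\<lambda>x. projection_estimator k n Z x - f x) \<partial>?Q X)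
    \<le> ennreal ((\<Sum>j=1..k. (B_const \<alpha> k)\<^sup>2 / real n + (?xbar X j - ?\<theta> j)\<^sup>2) + ?tail)" for X
  proof -
    have "(\<integral>\<^sup>+Z. sq_L2_norm (\<lambda>x. projection_estimator k n Z x - f x) \<partial>?Q X)
        \<le> (\<integral>\<^sup>+Z. ennreal ((\<Sum>j=1..k. (?zbar Z j - ?\<theta> j)\<^sup>2) + ?tail) \<partial>?Q X)"
      unfolding projection_estimator_def
      by (intro nn_integral_mono sq_L2_norm_trig_sum_le f r \<beta> k)
    also have "\<dots> = ennreal (\<integral>Z. (\<Sum>j=1..k. (?zbar Z j - ?\<theta> j)\<^sup>2) + ?tail \<partial>?Q X)"
      using mean_square_private_sample_le(1)[OF k \<alpha> n]
      by (intro nn_integral_eq_integral)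
        (auto intro!: Bochner_Integration.integrable_add Bochner_Integration.integrable_sum sum_nonneg add_nonneg_nonneg)
    also have "(\<integral>Z. (\<Sum>j=1..k. (?zbar Z j - ?\<theta> j)\<^sup>2) + ?tail \<partial>?Q X)
        = (\<Sum>j=1..k. \<integral>Z. (?zbar Z j - ?\<theta> j)\<^sup>2 \<partial>?Q X) + ?tail"
      using mean_square_private_sample_le(1)[OF k \<alpha> n]
      by (subst Bochner_Integration.integral_add)
        (auto intro!: Bochner_Integration.integrable_sum Bochner_Integration.integral_sum)
    also have "ennreal \<dots> \<le> ennreal ((\<Sum>j=1..k. (B_const \<alpha> k)\<^sup>2 / real n + (?xbar X j - ?\<theta> j)\<^sup>2) + ?tail)"
      using mean_square_private_sample_le(2)[OF k \<alpha> n]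
      by (intro ennreal_leI add_right_mono sum_mono) auto
    finally show ?thesis .
  qed
  have int: "integrable ?M (\<lambda>X. (?xbar X j - ?\<theta> j)\<^sup>2)" for j
    by (rule mean_square_sample_le(1)[OF n P meas])
  interpret M: prob_space ?M by fact
  have "private_risk \<alpha> k n ?P f
      \<le> (\<integral>\<^sup>+X. ennreal ((\<Sum>j=1..k. (B_const \<alpha> k)\<^sup>2 / real n + (?xbar X j - ?\<theta> j)\<^sup>2) + ?tail) \<partial>?M)"
    unfolding private_risk_def by (intro nn_integral_mono inner)
  also have "\<dots> = ennreal (\<integral>X. (\<Sum>j=1..k. (B_const \<alpha> k)\<^sup>2 / real n + (?xbar X j - ?\<theta> j)\<^sup>2) + ?tail \<partial>?M)"
    using int by (intro nn_integral_eq_integral)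
        (auto intro!: Bochner_Integration.integrable_add Bochner_Integration.integrable_sum sum_nonneg add_nonneg_nonneg)
  also have "(\<integral>X. (\<Sum>j=1..k. (B_const \<alpha> k)\<^sup>2 / real n + (?xbar X j - ?\<theta> j)\<^sup>2) + ?tail \<partial>?M)
      = (\<Sum>j=1..k. (B_const \<alpha> k)\<^sup>2 / real n + (\<integral>X. (?xbar X j - ?\<theta> j)\<^sup>2 \<partial>?M)) + ?tail"
    using int by (simp add: Bochner_Integration.integral_sum Bochner_Integration.integrable_sum M.prob_space)
  also have "\<dots> \<le> (\<Sum>j=1..k. (B_const \<alpha> k)\<^sup>2 / real n + (2 / real n + 8 * \<epsilon>\<^sup>2)) + ?tail"
    by (intro add_right_mono add_left_mono sum_mono
      order_trans[OF mean_square_sample_le(2)[OF n P meas]] contaminated_bias_sq_le[OF \<epsilon> f G])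
  also have "\<dots> = real k * (((B_const \<alpha> k)\<^sup>2 + 2) / real n + 8 * \<epsilon>\<^sup>2) + ?tail"
    by (simp add: add_divide_distrib add.assoc)
  finally show ?thesis by (simp add: ennreal_leI)
qed

section \<open>Rates\<close>

lemma tuning_rate_le:
  "tuning_rate \<beta> n \<alpha> \<epsilon> \<le> (real n * \<alpha>\<^sup>2) powr (1 / (2 * \<beta> + 2))"
  "\<epsilon> \<noteq> 0 \<Longrightarrow> tuning_rate \<beta> n \<alpha> \<epsilon> \<le> \<epsilon> powr (- 2 / (2 * \<beta> + 1))"
  by (simp_all add: tuning_rate_def)

lemma tuning_rate_pos:
  assumes "0 < real n * \<alpha>\<^sup>2"
  shows "0 < tuning_rate \<beta> n \<alpha> \<epsilon>"
proof -
  have "n \<noteq> 0" "\<alpha> \<noteq> 0" using assms by (cases "n = 0"; auto)+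
  then show ?thesis by (auto simp: tuning_rate_def)
qed

lemma risk_rate_pos:
  assumes "0 < real n * \<alpha>\<^sup>2"
  shows "0 < risk_rate \<beta> n \<alpha> \<epsilon>"
proof -
  have "n \<noteq> 0" "\<alpha> \<noteq> 0" using assms by (cases "n = 0"; auto)+
  then show ?thesis by (simp add: risk_rate_def less_max_iff_disj)
qed

text \<open>The truncation term: the tuning rate equals one of its two branches, and the power
  -2\<beta> sends each branch to the matching term of the maximum.\<close>

lemma tuning_rate_powr_le_risk_rate:
  assumes \<beta>: "0 < \<beta>" and N: "0 < real n * \<alpha>\<^sup>2" and \<epsilon>: "0 \<le> \<epsilon>"
  shows "tuning_rate \<beta> n \<alpha> \<epsilon> powr (- 2 * \<beta>) \<le> risk_rate \<beta> n \<alpha> \<epsilon>"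
proof -
  have "((real n * \<alpha>\<^sup>2) powr (1 / (2 * \<beta> + 2))) powr (- 2 * \<beta>) = (real n * \<alpha>\<^sup>2) powr (- (2 * \<beta>) / (2 * \<beta> + 2))"
    by (simp add: powr_powr)
  moreover have "(\<epsilon> powr (- 2 / (2 * \<beta> + 1))) powr (- 2 * \<beta>) = \<epsilon> powr (4 * \<beta> / (2 * \<beta> + 1))"
    by (simp add: powr_powr)
  ultimately show ?thesis
    by (auto simp: tuning_rate_def risk_rate_def min_def)
qed

text \<open>The variance term uses only the sample-size branch: 2/(2\<beta>+2) - 1 =
  -2\<beta>/(2\<beta>+2).\<close>

lemma tuning_rate_sq_div_le_risk_rate:
  assumes \<beta>: "0 < \<beta>" and N: "0 < real n * \<alpha>\<^sup>2"
  shows "(tuning_rate \<beta> n \<alpha> \<epsilon>)\<^sup>2 / (real n * \<alpha>\<^sup>2) \<le> risk_rate \<beta> n \<alpha> \<epsilon>"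
proof -
  let ?N = "real n * \<alpha>\<^sup>2"
  have "(tuning_rate \<beta> n \<alpha> \<epsilon>)\<^sup>2 \<le> (?N powr (1 / (2 * \<beta> + 2)))\<^sup>2"
    using tuning_rate_le(1) tuning_rate_pos[OF N] by (intro power_mono) (auto intro: less_imp_le)
  then have "(tuning_rate \<beta> n \<alpha> \<epsilon>)\<^sup>2 / ?N \<le> (?N powr (1 / (2 * \<beta> + 2)))\<^sup>2 / ?N"
    using N by (intro divide_right_mono) auto
  also have "\<dots> = ?N powr (1 / (2 * \<beta> + 2) + 1 / (2 * \<beta> + 2)) / ?N powr 1"
    by (simp only: power2_eq_square[of "_ powr _"] powr_add powr_one[OF less_imp_le[OF N]])
  also have "\<dots> = ?N powr (1 / (2 * \<beta> + 2) + 1 / (2 * \<beta> + 2) - 1)"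
    by (rule powr_diff[symmetric])
  also have "1 / (2 * \<beta> + 2) + 1 / (2 * \<beta> + 2) - 1 = - (2 * \<beta>) / (2 * \<beta> + 2)"
    using \<beta> by (simp add: field_simps)
  finally show ?thesis by (simp add: risk_rate_def)
qed

text \<open>The contamination term uses only the other branch: 2 - 2/(2\<beta>+1) =
  4\<beta>/(2\<beta>+1).\<close>

lemma tuning_rate_times_sq_le_risk_rate:
  assumes \<beta>: "0 < \<beta>" and \<epsilon>: "0 \<le> \<epsilon>" and N: "0 < real n * \<alpha>\<^sup>2"
  shows "tuning_rate \<beta> n \<alpha> \<epsilon> * \<epsilon>\<^sup>2 \<le> risk_rate \<beta> n \<alpha> \<epsilon>"
proof (cases "\<epsilon> = 0")
  case True
  then show ?thesis using risk_rate_pos[OF N] by (simp add: less_imp_le)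
next
  case False
  with \<epsilon> have "\<epsilon> > 0" by simp
  have "tuning_rate \<beta> n \<alpha> \<epsilon> * \<epsilon>\<^sup>2 \<le> \<epsilon> powr (- 2 / (2 * \<beta> + 1)) * \<epsilon>\<^sup>2"
    using tuning_rate_le(2)[OF False] by (intro mult_right_mono) auto
  also have "\<dots> = \<epsilon> powr (- 2 / (2 * \<beta> + 1)) * \<epsilon> powr 2"
    using \<open>\<epsilon> > 0\<close> by simp
  also have "\<dots> = \<epsilon> powr (- 2 / (2 * \<beta> + 1) + 2)"
    by (rule powr_add[symmetric])
  also have "- 2 / (2 * \<beta> + 1) + 2 = 4 * \<beta> / (2 * \<beta> + 1)"
    using \<beta> by (simp add: field_simps)
  finally show ?thesis by (simp add: risk_rate_def)
qed

text \<open>Here \<open>b\<close> stands for the square of \<open>B_const\<close>. The upper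
  comparison of \<open>k\<close> with the tuning rate controls the variance and bias terms, which
  grow with \<open>k\<close>; the lower one controls the truncation term, which decreases. Since
  k/\<alpha>^2 \<ge> 1, the sampling constant 2 is absorbed in 514 = 512 + 2.\<close>

lemma private_risk_bound_le_risk_rate:
  fixes k n :: nat and b :: real
  assumes \<beta>: "0 < \<beta>" and N: "0 < real n * \<alpha>\<^sup>2" and \<alpha>: "0 < \<alpha>" "\<alpha> < 1" and \<epsilon>: "0 \<le> \<epsilon>"
    and k: "1 \<le> k" and b: "b \<le> 512 * real k / \<alpha>\<^sup>2"
    and K: "0 < K" "real k \<le> K * tuning_rate \<beta> n \<alpha> \<epsilon>"
    and L: "0 < L" "tuning_rate \<beta> n \<alpha> \<epsilon> \<le> L * real k"
  shows "real k * ((b + 2) / real n + 8 * \<epsilon>\<^sup>2) + r\<^sup>2 * real k powr (- 2 * \<beta>)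
    \<le> (514 * K\<^sup>2 + 8 * K + r\<^sup>2 * L powr (2 * \<beta>)) * risk_rate \<beta> n \<alpha> \<epsilon>"
proof -
  let ?\<tau> = "tuning_rate \<beta> n \<alpha> \<epsilon>" and ?\<rho> = "risk_rate \<beta> n \<alpha> \<epsilon>"
  note \<tau> = tuning_rate_pos[OF N, of \<beta> \<epsilon>]
  have n: "0 < n" using N by (cases n) auto
  have "\<alpha>\<^sup>2 \<le> 1" using \<alpha> by (simp add: power_le_one)
  then have "1 \<le> real k / \<alpha>\<^sup>2" using \<alpha> k by (simp add: le_divide_eq)
  with b have "b + 2 \<le> 514 * real k / \<alpha>\<^sup>2" by simp
  then have "real k * ((b + 2) / real n) \<le> real k * (514 * real k / \<alpha>\<^sup>2 / real n)"
    by (intro mult_left_mono divide_right_mono) auto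
  also have "\<dots> = 514 * ((real k)\<^sup>2 / (real n * \<alpha>\<^sup>2))"
    by (simp add: power2_eq_square mult_ac)
  also have "\<dots> \<le> 514 * ((K * ?\<tau>)\<^sup>2 / (real n * \<alpha>\<^sup>2))"
    using K N by (intro mult_left_mono divide_right_mono power_mono) auto
  also have "\<dots> = 514 * K\<^sup>2 * (?\<tau>\<^sup>2 / (real n * \<alpha>\<^sup>2))"
    by (simp add: power_mult_distrib)
  also have "\<dots> \<le> 514 * K\<^sup>2 * ?\<rho>"
    by (intro mult_left_mono tuning_rate_sq_div_le_risk_rate \<beta> N) auto
  finally have 1: "real k * ((b + 2) / real n) \<le> 514 * K\<^sup>2 * ?\<rho>" .
  have "real k * (8 * \<epsilon>\<^sup>2) \<le> K * ?\<tau> * (8 * \<epsilon>\<^sup>2)"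
    using K by (intro mult_right_mono) auto
  also have "\<dots> = 8 * K * (?\<tau> * \<epsilon>\<^sup>2)" by simp
  also have "\<dots> \<le> 8 * K * ?\<rho>"
    using K by (intro mult_left_mono tuning_rate_times_sq_le_risk_rate \<beta> \<epsilon> N) auto
  finally have 2: "real k * (8 * \<epsilon>\<^sup>2) \<le> 8 * K * ?\<rho>" .
  have "real k powr (- 2 * \<beta>) \<le> (?\<tau> / L) powr (- 2 * \<beta>)"
    using L \<tau> \<beta> by (intro powr_mono2') (auto simp: divide_le_eq mult.commute)
  also have "\<dots> = L powr (2 * \<beta>) * ?\<tau> powr (- 2 * \<beta>)"
    using L \<tau> by (simp add: powr_divide powr_minus field_simps)
  also have "\<dots> \<le> L powr (2 * \<beta>) * ?\<rho>"
    by (intro mult_left_mono tuning_rate_powr_le_risk_rate \<beta> N \<epsilon>) auto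
  finally have "r\<^sup>2 * real k powr (- 2 * \<beta>) \<le> r\<^sup>2 * (L powr (2 * \<beta>) * ?\<rho>)"
    by (intro mult_left_mono) auto
  with 1 2 show ?thesis by (simp add: algebra_simps)
qed

text \<open>A limsup bound by \<open>c\<close> gives an eventual bound only for constants strictly
  above \<open>c\<close>; doubling provides the room.\<close>

lemma lesssim_by_imp_eventually_le:
  assumes "lesssim_by c (\<lambda>n. ennreal (a n)) (\<lambda>n. ennreal (b n))" and c: "0 < c"
    and a: "\<forall>\<^sub>F n in sequentially. 0 \<le> a n" and b: "\<forall>\<^sub>F n in sequentially. 0 < b n"
  shows "\<forall>\<^sub>F n in sequentially. a n \<le> 2 * c * b n"
proof -
  have "limsup (\<lambda>n. ennreal (a n) / ennreal (b n)) < ennreal (2 * c)"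
    using c by (intro le_less_trans[OF assms(1)[unfolded lesssim_by_def]]) (simp add: ennreal_less_iff)
  then have "\<forall>\<^sub>F n in sequentially. ennreal (a n) / ennreal (b n) < ennreal (2 * c)"
    by (rule Limsup_lessD)
  then show ?thesis
    using a b
  proof eventually_elim
    case (elim n)
    then have "a n / b n < 2 * c"
      using c by (simp add: divide_ennreal ennreal_less_iff)
    then show ?case using elim by (simp add: divide_less_eq)
  qed
qed

theorem theorem7:
  fixes \<beta> r c1 c2 :: real
  assumes "\<beta> > 1 / 2" and "r > 0" and "c1 > 0" and "c2 > 0"
  shows "\<exists>C>0. \<forall>(\<alpha> :: nat \<Rightarrow> real) (\<epsilon> :: nat \<Rightarrow> real) (k :: nat \<Rightarrow> nat)
             (f :: nat \<Rightarrow> real \<Rightarrow> real) (G :: nat \<Rightarrow> real measure).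
           (\<forall>n. 0 < \<alpha> n \<and> \<alpha> n < 1) \<longrightarrow>
           (\<forall>n. 0 \<le> \<epsilon> n \<and> \<epsilon> n \<le> 1) \<longrightarrow>
           filterlim (\<lambda>n. real n * (\<alpha> n)\<^sup>2) at_top sequentially \<longrightarrow>
           (\<forall>n. 1 \<le> k n) \<longrightarrow>
           lesssim_by c1 (\<lambda>n. ennreal (real (k n))) (\<lambda>n. ennreal (tuning_rate \<beta> n (\<alpha> n) (\<epsilon> n))) \<longrightarrow>
           lesssim_by c2 (\<lambda>n. ennreal (tuning_rate \<beta> n (\<alpha> n) (\<epsilon> n))) (\<lambda>n. ennreal (real (k n))) \<longrightarrow>
           (\<forall>n. f n \<in> sobolev_class \<beta> r) \<longrightarrow>
           (\<forall>n. prob_space (G n) \<and> sets (G n) = sets (restrict_space borel {0..1})) \<longrightarrow>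
           lesssim_by C
             (\<lambda>n. private_risk (\<alpha> n) (k n) n (contaminated (\<epsilon> n) (f n) (G n)) (f n))
             (\<lambda>n. ennreal (risk_rate \<beta> n (\<alpha> n) (\<epsilon> n)))"
proof -
  \<comment> \<open>The constants of the eventual two-sided comparison of \<open>k\<close> with the
    tuning rate; through them \<open>C\<close> depends on \<beta>, \<open>r\<close>,
    \<open>c1\<close> and \<open>c2\<close> only.\<close>
  define K where "K = 2 * c1"
  define L where "L = 2 * c2"
  define C where "C = 514 * K\<^sup>2 + 8 * K + r\<^sup>2 * L powr (2 * \<beta>)"
  have KL: "K > 0" "L > 0" using assms by (simp_all add: K_def L_def)
  have C: "C > 0" using KL by (simp add: C_def add_pos_nonneg)
  show ?thesis
  proof (intro exI[of _ C] conjI C allI impI)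
    fix \<alpha> \<epsilon> :: "nat \<Rightarrow> real" and k :: "nat \<Rightarrow> nat" and f :: "nat \<Rightarrow> real \<Rightarrow> real"
      and G :: "nat \<Rightarrow> real measure"
    assume \<alpha>: "\<forall>n. 0 < \<alpha> n \<and> \<alpha> n < 1" and \<epsilon>: "\<forall>n. 0 \<le> \<epsilon> n \<and> \<epsilon> n \<le> 1"
      and lim: "filterlim (\<lambda>n. real n * (\<alpha> n)\<^sup>2) at_top sequentially"
      and k: "\<forall>n. 1 \<le> k n"
      and k_le: "lesssim_by c1 (\<lambda>n. ennreal (real (k n))) (\<lambda>n. ennreal (tuning_rate \<beta> n (\<alpha> n) (\<epsilon> n)))"
      and k_ge: "lesssim_by c2 (\<lambda>n. ennreal (tuning_rate \<beta> n (\<alpha> n) (\<epsilon> n))) (\<lambda>n. ennreal (real (k n)))"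
      and f: "\<forall>n. f n \<in> sobolev_class \<beta> r"
      and G: "\<forall>n. prob_space (G n) \<and> sets (G n) = sets (restrict_space borel {0..1})"
    let ?\<tau> = "\<lambda>n. tuning_rate \<beta> n (\<alpha> n) (\<epsilon> n)" and ?\<rho> = "\<lambda>n. risk_rate \<beta> n (\<alpha> n) (\<epsilon> n)"
    have N: "\<forall>\<^sub>F n in sequentially. 0 < real n * (\<alpha> n)\<^sup>2"
      using lim by (simp add: filterlim_at_top_dense)
    have \<tau>: "\<forall>\<^sub>F n in sequentially. 0 < ?\<tau> n"
      using N by eventually_elim (rule tuning_rate_pos)
    have "\<forall>\<^sub>F n in sequentially. real (k n) \<le> 2 * c1 * ?\<tau> n"
      using k_le \<open>c1 > 0\<close> _ \<tau> by (rule lesssim_by_imp_eventually_le) simp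
    moreover have "\<forall>\<^sub>F n in sequentially. ?\<tau> n \<le> 2 * c2 * real (k n)"
      using k_ge \<open>c2 > 0\<close>
    proof (rule lesssim_by_imp_eventually_le)
      show "\<forall>\<^sub>F n in sequentially. 0 \<le> ?\<tau> n" using \<tau> by eventually_elim simp
      show "\<forall>\<^sub>F n in sequentially. 0 < real (k n)"
        using k by (intro always_eventually allI) (simp add: Suc_le_eq)
    qed
    ultimately have "\<forall>\<^sub>F n in sequentially.
      private_risk (\<alpha> n) (k n) n (contaminated (\<epsilon> n) (f n) (G n)) (f n) / ennreal (?\<rho> n) \<le> ennreal C"
      using N
    proof eventually_elim
      case (elim n)
      have n: "0 < n" using elim(3) by (cases "n = 0") auto
      note \<rho> = risk_rate_pos[OF elim(3), of \<beta> "\<epsilon> n"]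
      have "private_risk (\<alpha> n) (k n) n (contaminated (\<epsilon> n) (f n) (G n)) (f n)
        \<le> ennreal (real (k n) * (((B_const (\<alpha> n) (k n))\<^sup>2 + 2) / real n + 8 * (\<epsilon> n)\<^sup>2)
            + r\<^sup>2 * real (k n) powr (- 2 * \<beta>))"
        using assms \<alpha> \<epsilon> k f G n by (intro private_risk_le) auto
      also have "\<dots> \<le> ennreal (C * ?\<rho> n)"
        unfolding C_def using assms \<alpha> \<epsilon> k KL elim
        by (intro ennreal_leI private_risk_bound_le_risk_rate B_const_sq_le) (auto simp: K_def L_def)
      also have "\<dots> = ennreal (?\<rho> n) * ennreal C"
        using C \<rho> by (simp add: ennreal_mult mult.commute)
      finally show ?case
        using \<rho> by (intro divide_le_posI_ennreal) auto
    qed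
    then show "lesssim_by C
        (\<lambda>n. private_risk (\<alpha> n) (k n) n (contaminated (\<epsilon> n) (f n) (G n)) (f n)) (\<lambda>n. ennreal (?\<rho> n))"
      unfolding lesssim_by_def by (rule Limsup_bounded)
  qed
qed

end
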